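(* Let $r>0$, let $B_t$ be a planar Brownian motion started at $1$, and let $\hat\tau_r=\inf\{t:\arg(B_t)=r\}$, where $\arg(B_t)$ is the continuous determination of the argument along the path with $\arg(B_0)=0$. Then $B_{\hat\tau_r}$ has density with respect to arclength on the ray $\{ye^{ir}:y>0\}$ given by $$\rho^1_{\hat\tau_r}(ye^{ir})=\frac{1}{\pi y}\cdot\frac{r}{r^2+(\ln y)^2},\qquad y>0.$$
   Context: Planar Brownian motion started at $1$ almost surely never hits $0$, so the continuous argument along the path is well defined almost surely. $\rho^1_{\hat\tau_r}$ denotes the density of $B_{\hat\tau_r}$ with respect to arclength when $B_0=1$. *)

theory Defs
  imports "HOL-Probability.Probability"
begin

text \<open>
  Time is \<^typ>\<open>real\<close>, restricted to \<open>t \<ge> 0\<close>; values of \<open>B\<close> at negative times are irrelevant.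
  The starting point and path continuity are required only almost surely.
\<close>

definition (in prob_space) planar_brownian_motion ::
    "complex \<Rightarrow> (real \<Rightarrow> 'a \<Rightarrow> complex) \<Rightarrow> bool" where
  "planar_brownian_motion z B \<longleftrightarrow>
     (\<forall>t\<ge>0. random_variable borel (B t)) \<and>
     (AE \<omega> in M. B 0 \<omega> = z) \<and>
     (AE \<omega> in M. continuous_on {0..} (\<lambda>t. B t \<omega>)) \<and>
     (\<forall>(n::nat) t. 0 \<le> t 0 \<and> (\<forall>i<n. t i < t (Suc i)) \<longrightarrow>
        indep_vars (\<lambda>_. borel) (\<lambda>i \<omega>. B (t (Suc i)) \<omega> - B (t i) \<omega>) {..<n}) \<and>
     (\<forall>s t. 0 \<le> s \<and> s < t \<longrightarrow>
        distributed M lborel (\<lambda>\<omega>. B t \<omega> - B s \<omega>)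
          (\<lambda>w. ennreal (normal_density 0 (sqrt (t - s)) (Re w) *
                        normal_density 0 (sqrt (t - s)) (Im w))))"

text \<open>
  If \<open>\<gamma>\<close> is continuous and nonvanishing on \<open>{0..}\<close> with \<open>\<gamma> 0\<close> a positive real, such a \<open>\<theta>\<close> exists
  and its values on \<open>{0..}\<close> are uniquely determined; for other paths the value is unspecified.
\<close>

definition continuous_arg :: "(real \<Rightarrow> complex) \<Rightarrow> real \<Rightarrow> real" where
  "continuous_arg \<gamma> =
     (SOME \<theta>. continuous_on {0..} \<theta> \<and> \<theta> 0 = 0 \<and> (\<forall>t\<ge>0. is_Arg (\<gamma> t) (\<theta> t)))"

text \<open>The infimum is taken in \<^typ>\<open>ereal\<close>, so it is \<open>\<infinity>\<close> if the level \<open>r\<close> is never reached.\<close>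

definition arg_hitting_time :: "real \<Rightarrow> (real \<Rightarrow> complex) \<Rightarrow> ereal" where
  "arg_hitting_time r \<gamma> = Inf {ereal t | t. 0 \<le> t \<and> continuous_arg \<gamma> t = r}"

text \<open>
  The default value \<open>0\<close> for an infinite hitting time does not lie on the open ray. Hence a
  law with a density with respect to arclength on the ray forces the hitting time to be
  almost surely finite.
\<close>

definition arg_hitting_point :: "real \<Rightarrow> (real \<Rightarrow> complex) \<Rightarrow> complex" where
  "arg_hitting_point r \<gamma> =
     (if arg_hitting_time r \<gamma> < \<infinity> then \<gamma> (real_of_ereal (arg_hitting_time r \<gamma>)) else 0)"

text \<open>
  Arclength on the open ray at angle \<open>r\<close>, as a Borel measure on the plane: the image of
  Lebesgue measure under the unit-speed parametrisation.
\<close>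

definition ray_arclength :: "real \<Rightarrow> complex measure" where
  "ray_arclength r =
     distr (restrict_space lborel {0<..}) borel (\<lambda>y::real. complex_of_real y * cis r)"

end

theory Submission
  imports Defs "HOL-Complex_Analysis.Complex_Analysis"
begin

text \<open>
  On the universal cover of the punctured plane the path has a continuous logarithm
  \<open>W\<close> with \<open>W 0 = 0\<close>, and \<open>\<tau>\<close>, the hitting time of angle \<open>r\<close>, is the first time at which
  \<open>Im W\<close> reaches \<open>r\<close>.  For holomorphic \<open>g\<close> on a half plane containing \<open>{w. Im w \<le> r}\<close>,
  \<open>g(W)\<close> stopped at \<open>\<tau>\<close> should be a martingale by conformal invariance.  Apply this to
  \<open>g(w) = Ln (\<zeta> + \<i> w)\<close> with \<open>\<zeta> = s + r - \<i> b\<close>: its imaginary part is bounded and harmonic, equals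
  \<open>arctan ((x - b) / s)\<close> at \<open>x + \<i> r\<close>, and equals \<open>- arctan (b / (s + r))\<close> at \<open>0\<close>.  So
  \<open>X = ln \<bar>B \<tau>\<bar>\<close> satisfies \<open>E (arctan ((X - b) / s)) = - arctan (b / (s + r))\<close>, and \<open>s \<rightarrow> 0\<close> gives
  the distribution function of a Cauchy variable of scale \<open>r\<close>.  The density on the ray is that
  of \<open>exp X\<close>.

  The martingale property is obtained without stochastic calculus.  A Gaussian increment has
  a rotation invariant law, so the mean value property over circles says that adding
  \<open>Ln (1 + \<delta>)\<close>, where \<open>\<delta>\<close> is the increment divided by the current position, preserves the
  expectation of \<open>g\<close> exactly, even when increments with \<open>\<bar>\<delta>\<bar> > \<eta>\<close> are discarded
  (\<open>expectation_walk\<close>).  Discarding them keeps \<open>Ln\<close> on its principal branch and bounds the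
  overshoot of a stopped walk.  For a fixed continuous path that stays away from \<open>0\<close> nothing is
  discarded once the dyadic mesh is fine, and the walk then agrees with \<open>W\<close> at the grid points
  (\<open>walk_follows_log\<close>).  Because the dyadic grids are nested, the first grid time in a closed
  set decreases with the mesh and therefore converges; letting the level tend to \<open>r\<close> from below
  afterwards gives \<open>W \<tau>\<close> (\<open>walk_limits_to_hitting_point\<close>).

  Two almost sure facts make this applicable, and both come from the same exact martingales by
  Markov's inequality.  With \<open>g(w) = w\<close> the real part of the walk has mean \<open>0\<close>, so it is unlikely
  to reach a very negative level before a fixed positive one: the path never meets \<open>0\<close>
  (\<open>bm_nonzero\<close>).  With \<open>g(w) = Ln (c + \<i> w)\<close> the real part \<open>ln \<bar>c + \<i> w\<bar>\<close> is nonnegative, has fixed mean,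
  and is large when \<open>\<bar>B t\<bar>\<close> is large, which has probability tending to \<open>1\<close>: the angle \<open>r\<close> is
  reached almost surely (\<open>bm_hits_level\<close>).
\<close>

section \<open>Rotation invariance of planar Lebesgue measure\<close>

lemma nn_integral_lborel_complex:
  fixes f :: "complex \<Rightarrow> ennreal"
  assumes [measurable]: "f \<in> borel_measurable borel"
  shows "(\<integral>\<^sup>+z. f z \<partial>lborel) = (\<integral>\<^sup>+p. f (Complex (fst p) (snd p)) \<partial>(lborel \<Otimes>\<^sub>M lborel))"
proof -
  have meas [measurable]: "(\<lambda>p. Complex (fst p) (snd p)) \<in> borel_measurable ((lborel :: real measure) \<Otimes>\<^sub>M (lborel :: real measure))"
    unfolding Complex_eq by measurable
  have "lborel = distr (lborel \<Otimes>\<^sub>M lborel) borel (\<lambda>p. Complex (fst p) (snd p))"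
  proof (rule lborel_eqI)
    fix l u :: complex
    assume le: "\<And>b. b \<in> Basis \<Longrightarrow> l \<bullet> b \<le> u \<bullet> b"
    have "emeasure (distr (lborel \<Otimes>\<^sub>M lborel) borel (\<lambda>p. Complex (fst p) (snd p))) (box l u) =
      emeasure (lborel \<Otimes>\<^sub>M lborel) ({Re l<..<Re u} \<times> {Im l<..<Im u})"
      by (subst emeasure_distr)
         (auto simp: box_def Basis_complex_def space_pair_measure inner_complex_def intro!: arg_cong2[where f=emeasure])
    also have "\<dots> = ennreal (Re u - Re l) * ennreal (Im u - Im l)"
      using le[of 1] le[of \<i>]
      by (subst lborel.emeasure_pair_measure_Times) (auto simp: Basis_complex_def)
    also have "\<dots> = ennreal (\<Prod>b\<in>Basis. (u - l) \<bullet> b)"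
      using le[of 1] le[of \<i>] by (simp add: Basis_complex_def ennreal_mult complex_i_not_one)
    finally show "emeasure (distr (lborel \<Otimes>\<^sub>M lborel) borel (\<lambda>p. Complex (fst p) (snd p))) (box l u) = ennreal (\<Prod>b\<in>Basis. (u - l) \<bullet> b)" .
  qed simp
  then have "(\<integral>\<^sup>+z. f z \<partial>lborel) =
      (\<integral>\<^sup>+z. f z \<partial>distr (lborel \<Otimes>\<^sub>M lborel) borel (\<lambda>p. Complex (fst p) (snd p)))"
    by (rule arg_cong)
  then show ?thesis
    by (simp add: nn_integral_distr)
qed

text \<open>
  Shears preserve planar Lebesgue measure by Fubini's theorem and translation invariance on
  the line.
\<close>

lemma nn_integral_shear:
  fixes f :: "complex \<Rightarrow> ennreal" and a :: real
  assumes [measurable]: "f \<in> borel_measurable borel"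
  shows "(\<integral>\<^sup>+z. f (Complex (Re z + a * Im z) (Im z)) \<partial>lborel) = (\<integral>\<^sup>+z. f z \<partial>lborel)" 
    and "(\<integral>\<^sup>+z. f (Complex (Re z) (Im z + a * Re z)) \<partial>lborel) = (\<integral>\<^sup>+z. f z \<partial>lborel)" 
proof -
  have [measurable]: "(\<lambda>z::complex. Complex (Re z + a * Im z) (Im z)) \<in> borel_measurable borel"
     "(\<lambda>z::complex. Complex (Re z) (Im z + a * Re z)) \<in> borel_measurable borel"
     "(\<lambda>p. Complex (fst p) (snd p)) \<in> borel_measurable ((lborel :: real measure) \<Otimes>\<^sub>M (lborel :: real measure))"
     "(\<lambda>p. Complex (fst p + a * snd p) (snd p)) \<in> borel_measurable ((lborel :: real measure) \<Otimes>\<^sub>M (lborel :: real measure))"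
     "(\<lambda>p. Complex (fst p) (snd p + a * fst p)) \<in> borel_measurable ((lborel :: real measure) \<Otimes>\<^sub>M (lborel :: real measure))"
     "\<And>y. (\<lambda>x. Complex x y) \<in> borel_measurable borel"
     "\<And>y. (\<lambda>x. Complex y x) \<in> borel_measurable borel"
    unfolding Complex_eq by measurable
  show "(\<integral>\<^sup>+z. f (Complex (Re z + a * Im z) (Im z)) \<partial>lborel) = (\<integral>\<^sup>+z. f z \<partial>lborel)"
    apply (subst (1 2) nn_integral_lborel_complex; simp)
    apply (subst (1 2) lborel_pair.nn_integral_snd[symmetric]; simp)
    apply (rule nn_integral_cong)
    subgoal for y
      using nn_integral_real_affine[of "\<lambda>x. f (Complex x y)" 1 "a * y"] by (simp add: ac_simps)
    done
  show "(\<integral>\<^sup>+z. f (Complex (Re z) (Im z + a * Re z)) \<partial>lborel) = (\<integral>\<^sup>+z. f z \<partial>lborel)" 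
    apply (subst (1 2) nn_integral_lborel_complex; simp)
    apply (subst (1 2) lborel.nn_integral_fst[symmetric]; simp)
    apply (rule nn_integral_cong)
    subgoal for y
      using nn_integral_real_affine[of "\<lambda>x. f (Complex y x)" 1 "a * y"] by (simp add: ac_simps)
    done
qed

text \<open>
  A rotation other than the half turn is a product of three shears, and the half turn is
  the square of a quarter turn.
\<close>

lemma nn_integral_rotate:
  fixes f :: "complex \<Rightarrow> ennreal" and u :: complex
  assumes f [measurable]: "f \<in> borel_measurable borel" and u: "norm u = 1"
  shows "(\<integral>\<^sup>+z. f (u * z) \<partial>lborel) = (\<integral>\<^sup>+z. f z \<partial>lborel)"
proof -
  have main: "(\<integral>\<^sup>+z. f (u * z) \<partial>lborel) = (\<integral>\<^sup>+z. f z \<partial>lborel)" 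
    if f [measurable]: "f \<in> borel_measurable borel" and u: "norm u = 1" and ne: "u \<noteq> -1" 
    for f :: "complex \<Rightarrow> ennreal" and u
  proof -
    \<comment> \<open>for \<open>u = cis \<alpha>\<close> these are \<open>- tan (\<alpha> / 2)\<close> and \<open>sin \<alpha>\<close>\<close>
    define a where "a = - Im u / (1 + Re u)"
    define b where "b = Im u"
    have sq: "Re u * Re u + Im u * Im u = 1"
      using u by (simp add: cmod_def power2_eq_square)
    have "Re u \<noteq> -1"
    proof
      assume "Re u = -1"
      with sq have "Im u = 0" by simp
      with \<open>Re u = -1\<close> ne show False by (simp add: complex_eq_iff)
    qed
    then have d: "1 + Re u \<noteq> 0" by linarith
    have ab: "a * b = Re u - 1"
      using d sq unfolding a_def b_def by (simp add: field_simps)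
    have a1: "a * (1 + Re u) = - Im u" using d unfolding a_def by simp
    define s1 where "s1 = (\<lambda>z. Complex (Re z + a * Im z) (Im z))"
    define s2 where "s2 = (\<lambda>z. Complex (Re z) (Im z + b * Re z))"
    have [measurable]: "s1 \<in> borel_measurable borel" "s2 \<in> borel_measurable borel"
      unfolding s1_def s2_def Complex_eq by measurable
    have i1: "(\<integral>\<^sup>+z. h (s1 z) \<partial>lborel) = (\<integral>\<^sup>+z. h z \<partial>lborel)"
      and i2: "(\<integral>\<^sup>+z. h (s2 z) \<partial>lborel) = (\<integral>\<^sup>+z. h z \<partial>lborel)"
      if "h \<in> borel_measurable borel" for h :: "complex \<Rightarrow> ennreal"
      using nn_integral_shear[OF that] unfolding s1_def s2_def by auto
    have "u * z = s1 (s2 (s1 z))" for z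
    proof -
      have r: "Re (s1 (s2 (s1 z))) = (1 + a * b) * Re z + a * (1 + (1 + a * b)) * Im z"
        unfolding s1_def s2_def by (simp add: algebra_simps)
      have i: "Im (s1 (s2 (s1 z))) = (1 + a * b) * Im z + b * Re z"
        unfolding s1_def s2_def by (simp add: algebra_simps)
      show ?thesis
        using r i a1 unfolding ab by (simp add: complex_eq_iff b_def)
    qed
    then have "(\<integral>\<^sup>+z. f (u * z) \<partial>lborel) = (\<integral>\<^sup>+z. f (s1 (s2 (s1 z))) \<partial>lborel)" by simp
    also have "\<dots> = (\<integral>\<^sup>+z. f (s1 (s2 z)) \<partial>lborel)"
      by (rule i1) measurable
    also have "\<dots> = (\<integral>\<^sup>+z. f (s1 z) \<partial>lborel)"
      by (rule i2) measurable
    also have "\<dots> = (\<integral>\<^sup>+z. f z \<partial>lborel)"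
      by (rule i1) measurable
    finally show ?thesis .
  qed
  show ?thesis
  proof (cases "u = -1")
    case True
    have "(\<integral>\<^sup>+z. f (u * z) \<partial>lborel) = (\<integral>\<^sup>+z. f (\<i> * (\<i> * z)) \<partial>lborel)"
      by (simp add: True flip: mult.assoc)
    also have "\<dots> = (\<integral>\<^sup>+z. f (\<i> * z) \<partial>lborel)"
      by (rule main) (auto simp: complex_eq_iff)
    also have "\<dots> = (\<integral>\<^sup>+z. f z \<partial>lborel)"
      by (rule main) (auto simp: complex_eq_iff)
    finally show ?thesis .
  qed (use main assms in auto)
qed

lemma distr_rotate_radial:
  fixes u :: complex and p :: "real \<Rightarrow> ennreal"
  assumes [measurable]: "p \<in> borel_measurable borel" and u: "norm u = 1"
  defines "\<nu> \<equiv> density lborel (\<lambda>z. p (norm z))"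
  shows "distr \<nu> borel ((*) u) = \<nu>"
proof (rule measure_eqI)
  fix A assume "A \<in> sets (distr \<nu> borel ((*) u))"
  then have A [measurable]: "A \<in> sets borel" by simp
  have "emeasure (distr \<nu> borel ((*) u)) A = (\<integral>\<^sup>+z. indicator A z \<partial>distr \<nu> borel ((*) u))"
    by simp
  also have "\<dots> = (\<integral>\<^sup>+z. p (norm (u * z)) * indicator A (u * z) \<partial>lborel)"
    unfolding \<nu>_def by (subst nn_integral_distr) (simp_all add: nn_integral_density norm_mult u)
  also have "\<dots> = (\<integral>\<^sup>+z. p (norm z) * indicator A z \<partial>lborel)"
    by (rule nn_integral_rotate) (use u in auto)
  also have "\<dots> = emeasure \<nu> A"
    unfolding \<nu>_def by (simp add: emeasure_density)
  finally show "emeasure (distr \<nu> borel ((*) u)) A = emeasure \<nu> A" .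
qed (simp add: \<nu>_def)

section \<open>A walk along the branches of the logarithm\<close>

text \<open>
  Cauchy's integral formula on a circle, in the form of a mean over a full turn starting from
  an arbitrary point of the circle.
\<close>

lemma holomorphic_circle_average:
  assumes F: "F holomorphic_on ball 0 R" and z0: "norm z0 < R"
  shows "((\<lambda>t. F (z0 * cis (2 * pi * t))) has_integral F 0) {0..1}"
proof (cases "z0 = 0")
  case True
  then show ?thesis using has_integral_const_real[of "F 0" 0 1] by simp
next
  case False
  define r where "r = norm z0"
  have r: "0 < r" "r < R" using False z0 by (auto simp: r_def)
  define F' where "F' = (\<lambda>w. F (w * (z0 / of_real r)))"
  have "F' holomorphic_on cball 0 r"
    unfolding F'_def
    by (rule holomorphic_on_compose_gen[OF _ F, unfolded o_def])
       (use r in \<open>auto intro!: holomorphic_intros simp: norm_mult norm_divide r_def\<close>)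
  from Cauchy_integral_circlepath_simple[OF this, of 0]
  have "((\<lambda>u. F' u / u) has_contour_integral 2 * of_real pi * \<i> * F' 0) (circlepath 0 r)"
    using r by simp
  then have "((\<lambda>x. F' (circlepath 0 r x) / circlepath 0 r x * vector_derivative (circlepath 0 r) (at x))
     has_integral 2 * of_real pi * \<i> * F' 0) {0..1}"
    by (simp add: has_contour_integral)
  moreover have "F' (circlepath 0 r x) / circlepath 0 r x * vector_derivative (circlepath 0 r) (at x)
      = F (z0 * cis (2 * pi * x)) * (2 * of_real pi * \<i>)" for x
    unfolding vector_derivative_circlepath
    using r by (simp add: circlepath F'_def cis_conv_exp mult_ac)
  ultimately have "((\<lambda>x. F (z0 * cis (2 * pi * x)) * (2 * of_real pi * \<i>)) has_integral 2 * of_real pi * \<i> * F 0) {0..1}"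
    by (simp add: F'_def)
  from has_integral_mult_left[OF this, of "1 / (2 * of_real pi * \<i>)"]
  show ?thesis by simp
qed

text \<open>
  Averaging over all rotations does not change an integral against a radial law and replaces
  the integrand by its circle means.  Outside the disc of radius \<open>\<eta>\<close> the truncated integrand is
  constant, so that every circle mean equals \<open>F 0\<close> and no error term arises.  The value
  \<open>c = 0\<close> covers a walk whose position is \<open>0\<close>, in view of \<open>x / 0 = 0\<close>.
\<close>

lemma radial_truncated_mean_value:
  fixes p :: "real \<Rightarrow> ennreal" and F :: "complex \<Rightarrow> complex" and c :: complex
  assumes p [measurable]: "p \<in> borel_measurable borel"
    and \<nu>: "\<nu> = density lborel (\<lambda>z. p (norm z))" and prob: "prob_space \<nu>"
    and F: "F holomorphic_on ball 0 R" and \<eta>: "0 < \<eta>" "\<eta> < R"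
  defines "G \<equiv> \<lambda>z. if norm z \<le> \<eta> then F z else F 0"
  shows "(\<integral>v. G (v * c) \<partial>\<nu>) = F 0"
proof -
  interpret N: prob_space \<nu> by fact
  have sets\<nu> [measurable_cong, simp]: "sets \<nu> = sets borel" by (simp add: \<nu>)
  define U where "U = restrict_space lborel {0..1::real}"
  have setsU [measurable_cong]: "sets U = sets (restrict_space borel {0..1::real})"
    unfolding U_def by (simp add: sets_restrict_space)
  interpret U: prob_space U
    by standard (simp add: U_def emeasure_restrict_space space_restrict_space)
  interpret P: pair_prob_space U \<nu> ..
  have contF: "continuous_on (cball 0 \<eta>) F"
    using holomorphic_on_imp_continuous_on[OF F] \<eta> by (auto intro: continuous_on_subset)
  have "(\<lambda>z. if z \<in> cball 0 \<eta> then F z else F 0) \<in> borel_measurable borel"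
    by (rule borel_measurable_continuous_on_if) (auto intro: contF)
  then have G [measurable]: "G \<in> borel_measurable borel"
    unfolding G_def by (simp add: dist_norm)
  have "bounded (F ` cball 0 \<eta>)"
    by (intro compact_imp_bounded compact_continuous_image contF) auto
  then obtain C where C: "\<And>z. norm z \<le> \<eta> \<Longrightarrow> norm (F z) \<le> C"
    unfolding bounded_iff by (metis imageI mem_cball_0)
  have GC: "norm (G z) \<le> C" for z
    unfolding G_def using C \<eta> by auto
  have [measurable]: "(\<lambda>t. cis (2 * pi * t)) \<in> borel_measurable borel"
    by (intro borel_measurable_continuous_onI continuous_intros)
  have [measurable]: "(\<lambda>t. cis (2 * pi * t)) \<in> borel_measurable U"
    unfolding U_def by (intro measurable_restrict_space1) simp
  have rot: "(\<integral>v. G (cis (2 * pi * t) * v * c) \<partial>\<nu>) = (\<integral>v. G (v * c) \<partial>\<nu>)" for t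
  proof -
    have "(\<integral>v. G (v * c) \<partial>\<nu>) = (\<integral>v. G (v * c) \<partial>distr \<nu> borel ((*) (cis (2 * pi * t))))"
      unfolding \<nu> by (subst distr_rotate_radial) auto
    also have "\<dots> = (\<integral>v. G (cis (2 * pi * t) * v * c) \<partial>\<nu>)"
      by (subst integral_distr) (auto simp: mult.assoc)
    finally show ?thesis by simp
  qed
  have circ: "(\<integral>t. G (cis (2 * pi * t) * v * c) \<partial>U) = F 0" for v
  proof (cases "norm (v * c) \<le> \<eta>")
    case True
    define h where "h = (\<lambda>t. F ((v * c) * cis (2 * pi * t)))"
    have hi: "(h has_integral F 0) {0..1}"
      unfolding h_def by (rule holomorphic_circle_average[OF F]) (use True \<eta> in auto)
    have "continuous_on {0..1} h"
      unfolding h_def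
      by (rule continuous_on_compose2[OF contF]) (use True in \<open>auto intro!: continuous_intros simp: norm_mult\<close>)
    then have si: "set_integrable lborel {0..1} h"
      by (rule borel_integrable_atLeastAtMost')
    have "(\<integral>t. G (cis (2 * pi * t) * v * c) \<partial>U) = (\<integral>t. h t \<partial>U)"
      using True by (simp add: G_def norm_mult h_def mult_ac)
    also have "\<dots> = (LINT t:{0..1}|lborel. h t)"
      unfolding U_def by (subst integral_restrict_space) (auto simp: set_lebesgue_integral_def)
    also have "\<dots> = F 0"
      using set_borel_integral_eq_integral(2)[OF si] hi by (simp add: integral_unique)
    finally show ?thesis .
  next
    case False
    then have "\<And>t. G (cis (2 * pi * t) * v * c) = F 0"
      unfolding G_def by (simp add: norm_mult)
    then show ?thesis by (simp add: U.prob_space)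
  qed
  have "(\<integral>v. G (v * c) \<partial>\<nu>) = (\<integral>t. (\<integral>v. G (cis (2 * pi * t) * v * c) \<partial>\<nu>) \<partial>U)"
    by (simp add: rot U.prob_space)
  also have "\<dots> = (\<integral>v. (\<integral>t. G (cis (2 * pi * t) * v * c) \<partial>U) \<partial>\<nu>)"
  proof (rule P.Fubini_integral[symmetric])
    show "integrable (U \<Otimes>\<^sub>M \<nu>) (\<lambda>(t, v). G (cis (2 * pi * t) * v * c))"
      by (rule P.integrable_const_bound[where B=C]) (auto simp: GC)
  qed
  also have "\<dots> = F 0"
    by (simp add: circ N.prob_space)
  finally show ?thesis .
qed

definition truncated_Ln :: "real \<Rightarrow> complex \<Rightarrow> complex" where
  "truncated_Ln \<eta> z = (if norm z \<le> \<eta> then Ln (1 + z) else 0)"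

definition position :: "(nat \<Rightarrow> complex) \<Rightarrow> nat \<Rightarrow> complex" where
  "position d k = 1 + (\<Sum>j<k. d j)"

text \<open>
  The sequence \<open>d\<close> holds the increments of a planar walk started at \<open>1\<close>.  The value is a
  discrete logarithm of its position, frozen on entry into \<open>S\<close>; an increment that is large
  relative to the position is ignored, so that each step has norm at most \<open>2 * \<eta>\<close>.
\<close>

primrec walk :: "real \<Rightarrow> complex set \<Rightarrow> (nat \<Rightarrow> complex) \<Rightarrow> nat \<Rightarrow> complex" where
  "walk \<eta> S d 0 = 0"
| "walk \<eta> S d (Suc k) =
     (if walk \<eta> S d k \<in> S then walk \<eta> S d k else walk \<eta> S d k + truncated_Ln \<eta> (d k / position d k))"

lemma norm_truncated_Ln:
  assumes "0 \<le> \<eta>" "\<eta> < 1/2" shows "norm (truncated_Ln \<eta> z) \<le> 2 * \<eta>"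
  using norm_Ln_le[of z] assms by (auto simp: truncated_Ln_def)

lemma truncated_Ln_measurable [measurable]:
  assumes "\<eta> < 1" shows "truncated_Ln \<eta> \<in> borel_measurable borel"
proof -
  have "(\<lambda>z. if z \<in> cball 0 \<eta> then Ln (1 + z) else 0) \<in> borel_measurable borel"
  proof (rule borel_measurable_continuous_on_if)
    show "continuous_on (cball 0 \<eta>) (\<lambda>z. Ln (1 + z))"
    proof (intro continuous_intros)
      fix z :: complex assume "z \<in> cball 0 \<eta>"
      then have "\<bar>Re z\<bar> < 1" using abs_Re_le_cmod[of z] assms by (simp add: dist_norm)
      then show "1 + z \<notin> \<real>\<^sub>\<le>\<^sub>0" by (auto simp: complex_nonpos_Reals_iff)
    qed
  qed auto
  then show ?thesis
    unfolding truncated_Ln_def[abs_def] by (simp add: dist_norm)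
qed

lemma walk_cong:
  assumes "\<And>i. i < k \<Longrightarrow> d i = d' i"
  shows "walk \<eta> S d k = walk \<eta> S d' k" "position d k = position d' k"
proof -
  show "position d k = position d' k" using assms by (simp add: position_def)
  show "walk \<eta> S d k = walk \<eta> S d' k" using assms
  proof (induction k)
    case (Suc k)
    then have "walk \<eta> S d k = walk \<eta> S d' k" "position d k = position d' k" by (auto simp: position_def)
    with Suc.prems show ?case by simp
  qed simp
qed

lemma walk_measurable:
  assumes \<eta>: "\<eta> < 1" and S [measurable]: "S \<in> sets borel"
    and d: "\<And>i. i < k \<Longrightarrow> (\<lambda>x. d x i) \<in> borel_measurable N"
  shows "(\<lambda>x. walk \<eta> S (d x) k) \<in> borel_measurable N"
    and "(\<lambda>x. position (d x) k) \<in> borel_measurable N"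
proof -
  have P: "(\<lambda>x. position (d x) k) \<in> borel_measurable N" if "\<And>i. i < k \<Longrightarrow> (\<lambda>x. d x i) \<in> borel_measurable N" for k
    unfolding position_def using that by (intro borel_measurable_add borel_measurable_sum) auto
  show "(\<lambda>x. position (d x) k) \<in> borel_measurable N" by (intro P d)
  note [measurable] = truncated_Ln_measurable[OF \<eta>]
  show "(\<lambda>x. walk \<eta> S (d x) k) \<in> borel_measurable N" using d
  proof (induction k)
    case (Suc k)
    then have [measurable]: "(\<lambda>x. walk \<eta> S (d x) k) \<in> borel_measurable N"
      "(\<lambda>x. position (d x) k) \<in> borel_measurable N" "(\<lambda>x. d x k) \<in> borel_measurable N"
      by (auto intro: P)
    show ?case by simp
  qed simp
qed

lemma norm_walk_le:
  assumes "0 \<le> \<eta>" "\<eta> < 1/2"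
  shows "norm (walk \<eta> S d k) \<le> 2 * \<eta> * real k"
proof (induction k)
  case (Suc k)
  show ?case
    using Suc norm_triangle_ineq[of "walk \<eta> S d k" "truncated_Ln \<eta> (d k / position d k)"] norm_truncated_Ln[OF assms, of "d k / position d k"] assms
    by (simp add: algebra_simps)
qed simp

text \<open>
  The discrete optional stopping identity.  Given the first \<open>k\<close> increments, the next one is
  still radial by independence, and outside \<open>S\<close> the function \<open>z \<mapsto> g (y + Ln (1 + z))\<close> is
  holomorphic on a disc of radius \<open>2 * \<eta>\<close>, because \<open>\<bar>Ln (1 + z)\<bar> \<le> 2 * \<bar>z\<bar>\<close> there.  Hence the
  conditional mean of one step is \<open>g y\<close>.
\<close>

lemma (in prob_space) expectation_walk:
  fixes D :: "nat \<Rightarrow> 'a \<Rightarrow> complex" and g :: "complex \<Rightarrow> complex" and p :: "nat \<Rightarrow> real \<Rightarrow> ennreal"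
  assumes indep: "indep_vars (\<lambda>_. borel) D {..<K}"
    and dist: "\<And>k. k < K \<Longrightarrow> distributed M lborel (D k) (\<lambda>z. p k (norm z))"
    and p: "\<And>k. k < K \<Longrightarrow> p k \<in> borel_measurable borel"
    and \<eta>: "0 < \<eta>" "\<eta> < 1/4" and S [measurable]: "S \<in> sets borel"
    and g [measurable]: "g \<in> borel_measurable borel"
    and hol: "\<And>y. y \<notin> S \<Longrightarrow> g holomorphic_on ball y (4 * \<eta>)"
    and bdd: "\<And>k. \<exists>C. \<forall>d. norm (g (walk \<eta> S d k)) \<le> C"
    and "k \<le> K"
  shows "expectation (\<lambda>\<omega>. g (walk \<eta> S (\<lambda>i. D i \<omega>) k)) = g 0"
  using \<open>k \<le> K\<close>
proof (induction k)
  case 0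
  then show ?case by (simp add: prob_space)
next
  case (Suc k)
  then have k: "k < K" by simp
  note [measurable] = truncated_Ln_measurable[of \<eta>]
  define PK where "PK = PiM {..<k} (\<lambda>_::nat. borel :: complex measure)"
  define V where "V = D k"
  define V' where "V' = (\<lambda>\<omega>. restrict (\<lambda>i. D i \<omega>) {k})"
  define U where "U = (\<lambda>\<omega>. restrict (\<lambda>i. D i \<omega>) {..<k})"
  have D: "\<And>i. i < K \<Longrightarrow> random_variable borel (D i)"
    using indep unfolding indep_vars_def by auto
  have "indep_var PK U (PiM {k} (\<lambda>_. borel)) V'"
    unfolding PK_def U_def V'_def by (rule indep_var_restrict[OF indep]) (use k in auto)
  then have rvU [measurable]: "U \<in> measurable M PK"
    and rvV' [measurable]: "V' \<in> measurable M (PiM {k} (\<lambda>_. borel))"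
    and eq: "distr M PK U \<Otimes>\<^sub>M distr M (PiM {k} (\<lambda>_. borel)) V' =
      distr M (PK \<Otimes>\<^sub>M PiM {k} (\<lambda>_. borel)) (\<lambda>x. (U x, V' x))"
    by (auto simp: indep_var_distribution_eq)
  have rvV [measurable]: "V \<in> measurable M borel"
    using D[OF k] by (simp add: V_def)
  have V': "V' \<omega> k = V \<omega>" for \<omega> by (simp add: V'_def V_def)
  define Y where "Y = (\<lambda>u. walk \<eta> S u k)"
  define B where "B = (\<lambda>u. position u k)"
  have [measurable]: "Y \<in> borel_measurable PK" "B \<in> borel_measurable PK"
    unfolding Y_def B_def using \<eta> by (auto intro!: walk_measurable simp: PK_def)
  define h where "h = (\<lambda>(u, v). g (if Y u \<in> S then Y u else Y u + truncated_Ln \<eta> (v / B u)))"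
  define h' where "h' = (\<lambda>x. h (fst x, snd x (k::nat)))"
  have \<eta>1: "\<eta> < 1" using \<eta> by simp
  have hm [measurable]: "h \<in> borel_measurable (PK \<Otimes>\<^sub>M borel)"
    unfolding h_def using \<eta>1 by measurable
  have [measurable]: "h' \<in> borel_measurable (PK \<Otimes>\<^sub>M PiM {k} (\<lambda>_. borel))"
    unfolding h'_def by measurable
  have hU: "h (U \<omega>, V \<omega>) = g (walk \<eta> S (\<lambda>i. D i \<omega>) (Suc k))" for \<omega>
    using walk_cong(1)[of k "U \<omega>" "\<lambda>i. D i \<omega>" \<eta> S] walk_cong(2)[of k "U \<omega>" "\<lambda>i. D i \<omega>"] by (simp add: h_def Y_def B_def U_def V_def)
  have gY: "g (Y (U \<omega>)) = g (walk \<eta> S (\<lambda>i. D i \<omega>) k)" for \<omega>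
    using walk_cong(1)[of k "U \<omega>" "\<lambda>i. D i \<omega>" \<eta> S] walk_cong(2)[of k "U \<omega>" "\<lambda>i. D i \<omega>"] by (simp add: Y_def U_def)
  obtain C where C: "\<And>d. norm (g (walk \<eta> S d (Suc k))) \<le> C" using bdd by blast
  have hC: "norm (h (u, v)) \<le> C" for u v
  proof -
    have "h (u, v) = g (walk \<eta> S (u(k := v)) (Suc k))"
      using walk_cong(1)[of k "u(k := v)" u \<eta> S] walk_cong(2)[of k "u(k := v)" u] by (simp add: h_def Y_def B_def)
    then show ?thesis using C by simp
  qed
  interpret DU: prob_space "distr M PK U" by (rule prob_space_distr) simp
  interpret DV: prob_space "distr M borel V" by (rule prob_space_distr) simp
  interpret DV': prob_space "distr M (PiM {k} (\<lambda>_. borel)) V'" by (rule prob_space_distr) simp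
  interpret P: pair_prob_space "distr M PK U" "distr M (PiM {k} (\<lambda>_. borel)) V'" ..
  have int: "integrable (distr M PK U \<Otimes>\<^sub>M distr M (PiM {k} (\<lambda>_. borel)) V') h'"
    by (rule P.integrable_const_bound[where B=C]) (use hC in \<open>auto simp: h'_def\<close>)
  have dV: "distr M borel V = density lborel (\<lambda>z. p k (norm z))"
    using distributed_distr_eq_density[OF dist[OF k]] by (simp add: V_def cong: distr_cong)
  have inner: "(\<integral>v. h (u, v) \<partial>distr M borel V) = g (Y u)" for u
  proof (cases "Y u \<in> S")
    case True
    then show ?thesis using DV.prob_space by (simp add: h_def)
  next
    case False
    define F where "F = (\<lambda>z. g (Y u + Ln (1 + z)))"
    have "F holomorphic_on ball 0 (2 * \<eta>)"
      unfolding F_def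
    proof (rule holomorphic_on_compose_gen[OF _ hol[OF False], unfolded o_def])
      have "1 + z \<notin> \<real>\<^sub>\<le>\<^sub>0" if "norm z < 2 * \<eta>" for z :: complex
        using that \<eta> abs_Re_le_cmod[of z] by (auto simp: complex_nonpos_Reals_iff)
      then show "(\<lambda>z. Y u + Ln (1 + z)) holomorphic_on ball 0 (2 * \<eta>)"
        by (auto intro!: holomorphic_intros simp: dist_norm)
      show "(\<lambda>z. Y u + Ln (1 + z)) ` ball 0 (2 * \<eta>) \<subseteq> ball (Y u) (4 * \<eta>)"
      proof safe
        fix z :: complex assume "z \<in> ball 0 (2 * \<eta>)"
        then have "norm z < 2 * \<eta>" by simp
        moreover from this have "norm (Ln (1 + z)) \<le> 2 * norm z"
          using \<eta> by (intro norm_Ln_le) auto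
        ultimately show "Y u + Ln (1 + z) \<in> ball (Y u) (4 * \<eta>)"
          by (simp add: dist_norm)
      qed
    qed
    from radial_truncated_mean_value[OF p[OF k] dV DV.prob_space_axioms this, of \<eta> "1 / B u"] \<eta>
    have "(\<integral>v. (if norm (v * (1 / B u)) \<le> \<eta> then F (v * (1 / B u)) else F 0) \<partial>distr M borel V) = F 0"
      by simp
    moreover have "h (u, v) = (if norm (v * (1 / B u)) \<le> \<eta> then F (v * (1 / B u)) else F 0)" for v
      using False by (simp add: h_def F_def truncated_Ln_def)
    ultimately show ?thesis by (simp add: F_def)
  qed
  have "expectation (\<lambda>\<omega>. g (walk \<eta> S (\<lambda>i. D i \<omega>) (Suc k))) = expectation (\<lambda>\<omega>. h' (U \<omega>, V' \<omega>))"
    by (simp only: hU[symmetric] h'_def fst_conv snd_conv V')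
  also have "\<dots> = (\<integral>x. h' x \<partial>distr M (PK \<Otimes>\<^sub>M PiM {k} (\<lambda>_. borel)) (\<lambda>x. (U x, V' x)))"
    by (subst integral_distr) auto
  also have "\<dots> = (\<integral>x. h' x \<partial>(distr M PK U \<Otimes>\<^sub>M distr M (PiM {k} (\<lambda>_. borel)) V'))"
    by (simp only: eq)
  also have "\<dots> = (\<integral>u. (\<integral>f. h' (u, f) \<partial>distr M (PiM {k} (\<lambda>_. borel)) V') \<partial>distr M PK U)"
    by (rule P.integral_fst'[OF int, symmetric])
  also have "\<dots> = (\<integral>u. (\<integral>v. h (u, v) \<partial>distr M borel V) \<partial>distr M PK U)"
  proof (rule Bochner_Integration.integral_cong)
    fix u assume "u \<in> space (distr M PK U)"
    then have u: "u \<in> space PK" by simp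
    show "(\<integral>f. h' (u, f) \<partial>distr M (PiM {k} (\<lambda>_. borel)) V') = (\<integral>v. h (u, v) \<partial>distr M borel V)"
      using u by (simp add: integral_distr h'_def V')
  qed simp
  also have "\<dots> = (\<integral>u. g (Y u) \<partial>distr M PK U)"
    by (simp only: inner)
  also have "\<dots> = expectation (\<lambda>\<omega>. g (Y (U \<omega>)))"
    by (subst integral_distr) auto
  also have "\<dots> = g 0"
    using Suc by (simp only: gY)
  finally show ?case .
qed

section \<open>Sampled continuous paths\<close>

definition grid_increment :: "(real \<Rightarrow> complex) \<Rightarrow> nat \<Rightarrow> nat \<Rightarrow> complex" where
  "grid_increment \<gamma> n k = \<gamma> (real (Suc k) / 2 ^ n) - \<gamma> (real k / 2 ^ n)"

lemma position_grid_increment: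
  assumes "\<gamma> 0 = 1" shows "position (grid_increment \<gamma> n) k = \<gamma> (real k / 2 ^ n)"
  unfolding position_def grid_increment_def
  using sum_lessThan_telescope[of "\<lambda>k. \<gamma> (real k / 2 ^ n)" k] assms by simp

lemma eventually_mesh_small:
  fixes f :: "real \<Rightarrow> complex"
  assumes f: "continuous_on {0..} f" and e: "0 < e"
  shows "\<forall>\<^sub>F n in sequentially. \<forall>s t. 0 \<le> s \<and> s \<le> T \<and> 0 \<le> t \<and> t \<le> T \<and> \<bar>s - t\<bar> \<le> 1 / 2 ^ n
            \<longrightarrow> dist (f s) (f t) < e"
proof -
  have "continuous_on {0..T} f" using f by (rule continuous_on_subset) auto
  then have "uniformly_continuous_on {0..T} f"
    by (intro compact_uniformly_continuous) auto
  then obtain d where d: "d > 0" and D: "\<And>s t. s \<in> {0..T} \<Longrightarrow> t \<in> {0..T} \<Longrightarrow> dist t s < d \<Longrightarrow> dist (f t) (f s) < e"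
    using e unfolding uniformly_continuous_on_def by metis
  have "(\<lambda>n. (1/2 :: real) ^ n) \<longlonglongrightarrow> 0" by (intro LIMSEQ_power_zero) simp
  then have "\<forall>\<^sub>F n in sequentially. (1/2 :: real) ^ n < d"
    using d by (rule order_tendstoD)
  then show ?thesis
    by eventually_elim (use D in \<open>auto simp: dist_real_def power_one_over\<close>)
qed

lemma grid_le:
  assumes "k \<le> N * 2 ^ n" shows "real k / 2 ^ n \<le> real N"
proof -
  have "real k \<le> real (N * 2 ^ n)" using assms by (rule of_nat_mono)
  then show ?thesis by (simp add: field_simps)
qed

lemma grid_step: "\<bar>real (Suc k) / 2 ^ n - real k / 2 ^ n\<bar> \<le> 1 / 2 ^ n"
  by (simp add: field_simps)

lemma grid_ceil:
  fixes t :: real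
  assumes "0 \<le> t" "t \<le> real N"
  obtains k where "k \<le> N * 2 ^ n" "t \<le> real k / 2 ^ n" "real k / 2 ^ n - t \<le> 1 / 2 ^ n"
proof
  let ?k = "nat \<lceil>t * 2 ^ n\<rceil>"
  have nn: "0 \<le> t * 2 ^ n" using assms by simp
  have k: "real ?k = of_int \<lceil>t * 2 ^ n\<rceil>" using nn by (simp add: le_ceiling_iff)
  have "t * 2 ^ n \<le> real (N * 2 ^ n)" using assms by simp
  then have "\<lceil>t * 2 ^ n\<rceil> \<le> int (N * 2 ^ n)" by (simp add: ceiling_le_iff)
  then show "?k \<le> N * 2 ^ n" by linarith
  have 1: "t * 2 ^ n \<le> real ?k" and 2: "real ?k \<le> t * 2 ^ n + 1"
    unfolding k by linarith+
  show "t \<le> real ?k / 2 ^ n" using 1 by (simp add: field_simps)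
  have "real ?k / 2 ^ n - t = (real ?k - t * 2 ^ n) / 2 ^ n" by (simp add: field_simps)
  also have "\<dots> \<le> 1 / 2 ^ n" using 2 by (intro divide_right_mono) auto
  finally show "real ?k / 2 ^ n - t \<le> 1 / 2 ^ n" .
qed

text \<open>
  As long as the path stays outside the disc of radius \<open>exp (- a)\<close>, the increments on a fine
  grid are small relative to the position, so nothing is ignored and \<open>Re\<close> of the walk is the
  logarithm of the modulus.  A path that comes to \<open>0\<close> must therefore push the walk below \<open>- a\<close>,
  where it stays.
\<close>

lemma walk_detects_zero:
  fixes \<gamma> :: "real \<Rightarrow> complex"
  assumes cont: "continuous_on {0..} \<gamma>" and \<gamma>0: "\<gamma> 0 = 1"
    and t0: "0 \<le> t0" "t0 \<le> real N" "\<gamma> t0 = 0"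
    and \<kappa>: "0 < \<kappa>" "\<And>t. 0 \<le> t \<Longrightarrow> t \<le> real N \<Longrightarrow> norm (\<gamma> t) < exp \<kappa>"
    and a: "0 < a" and \<eta>: "0 < \<eta>" "\<eta> < 1"
  shows "\<forall>\<^sub>F n in sequentially. Re (walk \<eta> {w. Re w \<le> - a \<or> \<kappa> \<le> Re w} (grid_increment \<gamma> n) (N * 2 ^ n)) \<le> - a"
proof -
  let ?S = "{w. Re w \<le> - a \<or> \<kappa> \<le> Re w}"
  have "0 < \<eta> * exp (- a)" using \<eta> by simp
  from eventually_mesh_small[OF cont this, of "real N"] show ?thesis
  proof eventually_elim
    case (elim n)
    define Y where "Y = walk \<eta> ?S (grid_increment \<gamma> n)"
    define g where "g = (\<lambda>k::nat. \<gamma> (real k / 2 ^ n))"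
    have step: "norm (g (Suc k) - g k) < \<eta> * exp (- a)" if "Suc k \<le> N * 2 ^ n" for k
    proof -
      have "real (Suc k) / 2 ^ n \<le> real N" by (rule grid_le[OF that])
      moreover have "real k / 2 ^ n \<le> real N" by (rule grid_le) (use that in simp)
      moreover have "0 \<le> real (Suc k) / 2 ^ n" "0 \<le> real k / 2 ^ n" by simp_all
      ultimately have "dist (\<gamma> (real (Suc k) / 2 ^ n)) (\<gamma> (real k / 2 ^ n)) < \<eta> * exp (- a)"
        using elim grid_step[of k n] by blast
      then show ?thesis by (simp add: g_def dist_norm)
    qed
    \<comment> \<open>either the walk is already frozen below \<open>- a\<close>, or it is in step with the path\<close>
    have main: "Re (Y k) \<le> - a \<or> (exp (- a) < norm (g k) \<and> Re (Y k) = ln (norm (g k)))"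
      if "k \<le> N * 2 ^ n" for k
      using that
    proof (induction k)
      case 0
      then show ?case using a \<gamma>0 by (simp add: Y_def g_def)
    next
      case (Suc k)
      from Suc.IH Suc.prems consider "Re (Y k) \<le> - a"
        | "exp (- a) < norm (g k)" "Re (Y k) = ln (norm (g k))" "Re (Y k) > - a" by linarith
      then show ?case
      proof cases
        case 1
        then show ?thesis by (simp add: Y_def)
      next
        case 2
        have gk: "0 < norm (g k)" using 2(1) exp_gt_zero[of "-a"] by linarith
        then have gk0: "g k \<noteq> 0" by simp
        have "norm (g k) < exp \<kappa>"
          unfolding g_def using Suc.prems by (intro \<kappa>(2) grid_le) auto
        then have "ln (norm (g k)) < \<kappa>" using gk by (metis exp_less_cancel_iff exp_ln)
        then have nS: "Y k \<notin> ?S" using 2 by auto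
        define \<delta> where "\<delta> = grid_increment \<gamma> n k / position (grid_increment \<gamma> n) k"
        have \<delta>: "\<delta> = (g (Suc k) - g k) / g k"
          unfolding \<delta>_def position_grid_increment[of \<gamma>, OF \<gamma>0] by (simp add: grid_increment_def g_def)
        have "norm (g (Suc k) - g k) \<le> \<eta> * norm (g k)"
          using step[OF Suc.prems] 2(1) \<eta> mult_strict_left_mono[OF 2(1), of \<eta>] by linarith
        then have n\<delta>: "norm \<delta> \<le> \<eta>"
          unfolding \<delta> using gk by (simp add: norm_divide field_simps)
        have r: "1 + \<delta> = g (Suc k) / g k" unfolding \<delta> using gk0 by (simp add: field_simps)
        have "norm \<delta> < 1" using n\<delta> \<eta> by simp
        then have "1 + \<delta> \<noteq> 0" by (metis add.inverse_inverse add_eq_0_iff norm_minus_cancel norm_one order_less_irrefl)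
        then have gs0: "g (Suc k) \<noteq> 0" using r by auto
        have "Y (Suc k) = Y k + Ln (g (Suc k) / g k)"
          using nS n\<delta> by (simp add: Y_def truncated_Ln_def r flip: \<delta>_def)
        then have "Re (Y (Suc k)) = ln (norm (g (Suc k)))"
          using gk0 gs0 2 by (simp add: Re_Ln norm_divide ln_div)
        moreover have "exp (- a) < norm (g (Suc k))" if "- a < ln (norm (g (Suc k)))"
          using that gs0 by (metis exp_less_cancel_iff exp_ln zero_less_norm_iff)
        ultimately show ?thesis by linarith
      qed
    qed
    obtain k where k: "k \<le> N * 2 ^ n" "t0 \<le> real k / 2 ^ n" "real k / 2 ^ n - t0 \<le> 1 / 2 ^ n"
      using grid_ceil[OF t0(1,2)] by blast
    have "dist (\<gamma> (real k / 2 ^ n)) (\<gamma> t0) < \<eta> * exp (- a)"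
      using elim[rule_format, of "real k / 2 ^ n" t0] k t0 grid_le[OF k(1)] by simp
    then have "norm (g k) < \<eta> * exp (- a)" using t0 by (simp add: g_def)
    also have "\<dots> \<le> exp (- a)" using \<eta> by simp
    finally have Yk: "Re (Y k) \<le> - a" using main[OF k(1)] by auto
    have "Re (Y (k + i)) \<le> - a" for i
      by (induction i) (use Yk in \<open>auto simp: Y_def\<close>)
    from this[of "N * 2 ^ n - k"] k(1) show "Re (walk \<eta> ?S (grid_increment \<gamma> n) (N * 2 ^ n)) \<le> - a"
      by (simp add: Y_def)
  qed
qed

text \<open>
  On a fine grid consecutive values of \<open>W\<close> differ by less than \<open>pi\<close>, which makes \<open>Ln\<close> of the
  quotient of consecutive positions equal to the increment of \<open>W\<close>.  Here \<open>j\<close> is the index at which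
  the walk has been frozen, or \<open>k\<close> if it has not.
\<close>

lemma walk_follows_log:
  fixes W :: "real \<Rightarrow> complex"
  assumes cont: "continuous_on {0..} W" and W0: "W 0 = 0" and \<gamma>: "\<And>t. 0 \<le> t \<Longrightarrow> \<gamma> t = exp (W t)"
    and \<eta>: "0 < \<eta>"
  shows "\<forall>\<^sub>F n in sequentially. \<forall>k \<le> N * 2 ^ n. \<exists>j \<le> k. walk \<eta> S (grid_increment \<gamma> n) k = W (real j / 2 ^ n) \<and>
     (\<forall>i<j. W (real i / 2 ^ n) \<notin> S) \<and> (j < k \<longrightarrow> W (real j / 2 ^ n) \<in> S)"
proof -
  have "isCont exp (0::complex)" by simp
  then obtain d where d: "d > 0" "\<And>z::complex. norm z < d \<Longrightarrow> norm (exp z - 1) < \<eta>"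
    using \<eta> unfolding continuous_at_eps_delta by (auto simp: dist_norm)
  have e: "0 < min d pi" using d by simp
  have \<gamma>0: "\<gamma> 0 = 1" using \<gamma>[of 0] W0 by simp
  from eventually_mesh_small[OF cont e, of "real N"] show ?thesis
  proof eventually_elim
    case (elim n)
    show ?case
    proof (intro allI impI)
      fix k assume "k \<le> N * 2 ^ n"
      then show "\<exists>j \<le> k. walk \<eta> S (grid_increment \<gamma> n) k = W (real j / 2 ^ n) \<and>
        (\<forall>i<j. W (real i / 2 ^ n) \<notin> S) \<and> (j < k \<longrightarrow> W (real j / 2 ^ n) \<in> S)"
      proof (induction k)
        case 0
        then show ?case using W0 by simp
      next
        case (Suc k)
        then obtain j where j: "j \<le> k" "walk \<eta> S (grid_increment \<gamma> n) k = W (real j / 2 ^ n)"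
          "\<forall>i<j. W (real i / 2 ^ n) \<notin> S" "j < k \<longrightarrow> W (real j / 2 ^ n) \<in> S" by auto
        show ?case
        proof (cases "W (real j / 2 ^ n) \<in> S")
          case True
          then show ?thesis using j by (intro exI[of _ j]) auto
        next
          case False
          with j have jk: "j = k" by auto
          define \<Delta> where "\<Delta> = W (real (Suc k) / 2 ^ n) - W (real k / 2 ^ n)"
          have "real (Suc k) / 2 ^ n \<le> real N" by (rule grid_le[OF Suc.prems])
          moreover have "real k / 2 ^ n \<le> real N" by (rule grid_le) (use Suc.prems in simp)
          moreover have "0 \<le> real (Suc k) / 2 ^ n" "0 \<le> real k / 2 ^ n" by simp_all
          ultimately have "dist (W (real (Suc k) / 2 ^ n)) (W (real k / 2 ^ n)) < min d pi"
            using elim grid_step[of k n] by blast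
          then have \<Delta>: "norm \<Delta> < d" "norm \<Delta> < pi" by (auto simp: \<Delta>_def dist_norm)
          have "\<bar>Im \<Delta>\<bar> < pi" using abs_Im_le_cmod[of \<Delta>] \<Delta>(2) by linarith
          then have "Ln (exp \<Delta>) = \<Delta>" by (intro Ln_exp) auto
          moreover have "grid_increment \<gamma> n k / position (grid_increment \<gamma> n) k = exp \<Delta> - 1"
            unfolding position_grid_increment[of \<gamma>, OF \<gamma>0] grid_increment_def \<Delta>_def by (simp add: \<gamma> exp_diff field_simps)
          ultimately have "truncated_Ln \<eta> (grid_increment \<gamma> n k / position (grid_increment \<gamma> n) k) = \<Delta>"
            using d(2)[OF \<Delta>(1)] by (simp add: truncated_Ln_def)
          then have "walk \<eta> S (grid_increment \<gamma> n) (Suc k) = W (real (Suc k) / 2 ^ n)"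
            using j(2) False jk by (simp add: \<Delta>_def)
          then show ?thesis
            using j(3) False jk by (intro exI[of _ "Suc k"]) (auto simp: less_Suc_eq)
        qed
      qed
    qed
  qed
qed

lemma walk_eq_log_if_avoids:
  fixes W :: "real \<Rightarrow> complex"
  assumes "continuous_on {0..} W" "W 0 = 0" "\<And>t. 0 \<le> t \<Longrightarrow> \<gamma> t = exp (W t)" "0 < \<eta>"
    and avoid: "\<And>t. 0 \<le> t \<Longrightarrow> W t \<notin> S"
  shows "\<forall>\<^sub>F n in sequentially. walk \<eta> S (grid_increment \<gamma> n) (N * 2 ^ n) = W (real N)"
  using walk_follows_log[where W=W and \<gamma>=\<gamma> and \<eta>=\<eta> and N=N and S=S, OF assms(1-4), simplified]
proof eventually_elim
  case (elim n)
  then obtain j where j: "j \<le> N * 2 ^ n" "walk \<eta> S (grid_increment \<gamma> n) (N * 2 ^ n) = W (real j / 2 ^ n)"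
    "j < N * 2 ^ n \<longrightarrow> W (real j / 2 ^ n) \<in> S" by auto
  have "j = N * 2 ^ n" using j avoid[of "real j / 2 ^ n"] by auto
  then show ?case using j(2) by simp
qed

text \<open>
  The grids are nested, hence the first grid time in \<open>S\<close> decreases as the mesh is refined and
  its limit \<open>s\<close> exists.  The limit need not be the first hitting time of \<open>S\<close>, since the grid may
  miss a visit to the boundary of \<open>S\<close>; the last two properties are what remains true.
\<close>

lemma walk_converges:
  fixes W :: "real \<Rightarrow> complex"
  assumes cont: "continuous_on {0..} W" and W0: "W 0 = 0" and \<gamma>: "\<And>t. 0 \<le> t \<Longrightarrow> \<gamma> t = exp (W t)"
    and \<eta>: "0 < \<eta>" and S: "closed S"
  obtains s where "0 \<le> s" "s \<le> real N" "(\<lambda>n. walk \<eta> S (grid_increment \<gamma> n) (N * 2 ^ n)) \<longlonglongrightarrow> W s"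
    "s < real N \<Longrightarrow> W s \<in> S"
    "\<And>t. 0 \<le> t \<Longrightarrow> t < real N \<Longrightarrow> W t \<in> interior S \<Longrightarrow> s \<le> t"
proof -
  let ?Y = "\<lambda>n. walk \<eta> S (grid_increment \<gamma> n) (N * 2 ^ n)"
  define P where "P n j \<longleftrightarrow> j \<le> N * 2 ^ n \<and> ?Y n = W (real j / 2 ^ n) \<and>
     (\<forall>i<j. W (real i / 2 ^ n) \<notin> S) \<and> (j < N * 2 ^ n \<longrightarrow> W (real j / 2 ^ n) \<in> S)" for n j
  have "\<forall>\<^sub>F n in sequentially. \<exists>j. P n j"
    using walk_follows_log[where W=W and \<gamma>=\<gamma> and \<eta>=\<eta> and N=N and S=S, OF cont W0 \<gamma> \<eta>, simplified]
    by eventually_elim (auto simp: P_def)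
  then obtain n0 where "\<And>n. n \<ge> n0 \<Longrightarrow> \<exists>j. P n j"
    unfolding eventually_sequentially by blast
  then have "\<exists>j. \<forall>n. n \<ge> n0 \<longrightarrow> P n (j n)"
    by (intro choice) blast
  then obtain j where P: "\<And>n. n \<ge> n0 \<Longrightarrow> P n (j n)" by blast
  have j: "\<And>n. n \<ge> n0 \<Longrightarrow> j n \<le> N * 2 ^ n" "\<And>n. n \<ge> n0 \<Longrightarrow> ?Y n = W (real (j n) / 2 ^ n)"
    "\<And>n i. n \<ge> n0 \<Longrightarrow> i < j n \<Longrightarrow> W (real i / 2 ^ n) \<notin> S"
    "\<And>n. n \<ge> n0 \<Longrightarrow> j n < N * 2 ^ n \<Longrightarrow> W (real (j n) / 2 ^ n) \<in> S"
    using P unfolding P_def by auto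
  define \<sigma> where "\<sigma> i = real (j (i + n0)) / 2 ^ (i + n0)" for i
  have \<sigma>0: "0 \<le> \<sigma> i" "\<sigma> i \<le> real N" for i
    unfolding \<sigma>_def using grid_le[OF j(1)] by auto
  have "\<sigma> (Suc i) \<le> \<sigma> i" for i
  proof -
    let ?n = "i + n0"
    have "j (Suc ?n) \<le> 2 * j ?n"
    proof (rule ccontr)
      assume less: "\<not> j (Suc ?n) \<le> 2 * j ?n"
      then have "W (real (2 * j ?n) / 2 ^ Suc ?n) \<notin> S" by (intro j(3)) auto
      then have "\<not> j ?n < N * 2 ^ ?n" using j(4)[of ?n] by auto
      with less j(1)[of "Suc ?n"] show False by simp
    qed
    then have "real (j (Suc ?n)) \<le> 2 * real (j ?n)" by linarith
    then show ?thesis by (simp add: \<sigma>_def field_simps)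
  qed
  then have "decseq \<sigma>" by (simp add: decseq_Suc_iff)
  then obtain s where s: "\<sigma> \<longlonglongrightarrow> s" "\<And>i. s \<le> \<sigma> i"
    using decseq_convergent[of \<sigma> 0] \<sigma>0 by blast
  have s0: "0 \<le> s" using \<sigma>0 s(1) by (intro LIMSEQ_le_const) auto
  have sN: "s \<le> real N" using \<sigma>0(2)[of 0] s(2)[of 0] by linarith
  have lim: "(\<lambda>i. W (\<sigma> i)) \<longlonglongrightarrow> W s"
    by (rule continuous_on_tendsto_compose[OF cont s(1)]) (use s0 \<sigma>0 in auto)
  show ?thesis
  proof (rule that[OF s0 sN])
    have "(\<lambda>i. ?Y (i + n0)) \<longlonglongrightarrow> W s"
      using lim by (simp add: j(2) \<sigma>_def)
    then show "?Y \<longlonglongrightarrow> W s" by (rule LIMSEQ_offset)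
  next
    assume "s < real N"
    then have "\<forall>\<^sub>F i in sequentially. \<sigma> i < real N" using s(1) by (intro order_tendstoD)
    then have "\<forall>\<^sub>F i in sequentially. W (\<sigma> i) \<in> S"
    proof eventually_elim
      case (elim i)
      then have "real (j (i + n0)) < real (N * 2 ^ (i + n0))" by (simp add: \<sigma>_def field_simps)
      then have "j (i + n0) < N * 2 ^ (i + n0)" by (rule of_nat_less_imp_less)
      then show ?case unfolding \<sigma>_def by (intro j(4)) auto
    qed
    then show "W s \<in> S"
      by (rule Lim_in_closed_set[OF S _ _ lim]) simp
  next
    fix t :: real assume t: "0 \<le> t" "t < real N" "W t \<in> interior S"
    have "\<exists>k::nat. t \<le> real k / 2 ^ (i + n0) \<and> real k / 2 ^ (i + n0) - t \<le> 1 / 2 ^ (i + n0)" for i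
    proof -
      obtain k where "k \<le> N * 2 ^ (i + n0)" "t \<le> real k / 2 ^ (i + n0)" "real k / 2 ^ (i + n0) - t \<le> 1 / 2 ^ (i + n0)"
        using grid_ceil[of t N "i + n0"] t by auto
      then show ?thesis by blast
    qed
    then have "\<exists>k::nat \<Rightarrow> nat. \<forall>i. t \<le> real (k i) / 2 ^ (i + n0) \<and> real (k i) / 2 ^ (i + n0) - t \<le> 1 / 2 ^ (i + n0)"
      by (intro choice allI)
    then obtain k :: "nat \<Rightarrow> nat" where k: "\<And>i. t \<le> real (k i) / 2 ^ (i + n0)" "\<And>i. real (k i) / 2 ^ (i + n0) - t \<le> 1 / 2 ^ (i + n0)"
      by blast
    define x where "x i = real (k i) / 2 ^ (i + n0)" for i
    have "(\<lambda>i. (1/2 :: real) ^ (i + n0)) \<longlonglongrightarrow> 0"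
      by (intro LIMSEQ_ignore_initial_segment LIMSEQ_power_zero) simp
    then have z: "(\<lambda>i. t + 1 / 2 ^ (i + n0)) \<longlonglongrightarrow> t + 0"
      by (intro tendsto_add) (auto simp: power_one_over)
    have x: "x \<longlonglongrightarrow> t"
    proof (rule tendsto_sandwich)
      show "\<forall>\<^sub>F i in sequentially. t \<le> x i" using k(1) by (simp add: x_def)
      show "\<forall>\<^sub>F i in sequentially. x i \<le> t + 1 / 2 ^ (i + n0)"
        using k(2) by (simp add: x_def algebra_simps)
    qed (use z in auto)
    have "(\<lambda>i. W (x i)) \<longlonglongrightarrow> W t"
      by (rule continuous_on_tendsto_compose[OF cont x]) (auto simp: t x_def)
    then have "\<forall>\<^sub>F i in sequentially. W (x i) \<in> interior S"
      using t(3) by (intro topological_tendstoD) auto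
    then have "\<forall>\<^sub>F i in sequentially. \<sigma> i \<le> x i"
    proof eventually_elim
      case (elim i)
      then have "W (real (k i) / 2 ^ (i + n0)) \<in> S" using interior_subset by (auto simp: x_def)
      then have "\<not> k i < j (i + n0)" using j(3)[of "i + n0" "k i"] by auto
      then show ?case by (simp add: \<sigma>_def x_def divide_right_mono)
    qed
    then show "s \<le> t"
      by (intro tendsto_le[OF _ x s(1)]) auto
  qed
qed

text \<open>
  Approaching the level \<open>r\<close> from below repairs the possible delay: the limit time for the
  level \<open>\<rho> m\<close> is at most \<open>\<tau>\<close>, because near \<open>\<tau>\<close> the path is strictly above \<open>\<rho> m\<close>, and it has height at
  least \<open>\<rho> m\<close>, which before time \<open>\<tau>\<close> is possible only close to \<open>\<tau>\<close>.
\<close>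

lemma walk_limits_to_hitting_point:
  fixes W :: "real \<Rightarrow> complex" and \<rho> :: "nat \<Rightarrow> real"
  assumes cont: "continuous_on {0..} W" and W0: "W 0 = 0" and \<gamma>: "\<And>t. 0 \<le> t \<Longrightarrow> \<gamma> t = exp (W t)"
    and \<eta>: "0 < \<eta>" 
    and \<tau>: "0 \<le> \<tau>" "Im (W \<tau>) = r" "\<And>t. 0 \<le> t \<Longrightarrow> t < \<tau> \<Longrightarrow> Im (W t) < r"
    and \<rho>: "\<rho> \<longlonglongrightarrow> r" "\<And>m. \<rho> m < r"
  obtains y where "\<And>m. (\<lambda>n. walk \<eta> {w. \<rho> m \<le> Im w} (grid_increment \<gamma> n) (m * 2 ^ n)) \<longlonglongrightarrow> y m"
    and "y \<longlonglongrightarrow> W \<tau>"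
proof -
  let ?S = "\<lambda>m. {w. \<rho> m \<le> Im w}"
  have cl: "closed (?S m)" for m by (intro closed_Collect_le continuous_intros)
  have "open {w. \<rho> m < Im w}" for m by (intro open_Collect_less continuous_intros)
  then have int: "{w. \<rho> m < Im w} \<subseteq> interior (?S m)" for m by (intro interior_maximal) auto
  define Q where "Q m s \<longleftrightarrow> 0 \<le> s \<and> (\<lambda>n. walk \<eta> (?S m) (grid_increment \<gamma> n) (m * 2 ^ n)) \<longlonglongrightarrow> W s \<and>
    (s < real m \<longrightarrow> W s \<in> ?S m) \<and> (\<forall>t. 0 \<le> t \<and> t < real m \<and> W t \<in> interior (?S m) \<longrightarrow> s \<le> t)" for m s
  have "\<exists>s. Q m s" for m
    by (rule walk_converges[where W=W and \<gamma>=\<gamma> and \<eta>=\<eta> and S="?S m" and N=m, OF cont W0 \<gamma> \<eta> cl])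
       (auto simp: Q_def)
  then obtain s where Q: "\<And>m. Q m (s m)" by metis
  have s: "\<And>m. 0 \<le> s m"
    "\<And>m. (\<lambda>n. walk \<eta> (?S m) (grid_increment \<gamma> n) (m * 2 ^ n)) \<longlonglongrightarrow> W (s m)"
    "\<And>m. s m < real m \<Longrightarrow> W (s m) \<in> ?S m"
    "\<And>m t. 0 \<le> t \<Longrightarrow> t < real m \<Longrightarrow> W t \<in> interior (?S m) \<Longrightarrow> s m \<le> t"
    using Q unfolding Q_def by auto
  have ev: "\<forall>\<^sub>F m in sequentially. \<tau> < real m"
    using filterlim_at_top_dense[THEN iffD1, OF filterlim_real_sequentially] by blast
  have le: "\<forall>\<^sub>F m in sequentially. s m \<le> \<tau> \<and> \<rho> m \<le> Im (W (s m))"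
    using ev
  proof eventually_elim
    case (elim m)
    then have "s m \<le> \<tau>"
      using \<tau> \<rho>(2)[of m] int[of m] by (intro s(4)) auto
    moreover from this have "W (s m) \<in> ?S m" using elim by (intro s(3)) auto
    ultimately show ?case by auto
  qed
  have "s \<longlonglongrightarrow> \<tau>"
  proof (rule order_tendstoI)
    fix a assume "\<tau> < a"
    with le show "\<forall>\<^sub>F m in sequentially. s m < a" by (auto elim: eventually_mono)
  next
    fix a assume a: "a < \<tau>"
    show "\<forall>\<^sub>F m in sequentially. a < s m"
    proof (cases "a < 0")
      case True
      then show ?thesis using s(1) less_le_trans by (intro always_eventually) blast
    next
      case False
      have "continuous_on {0..a} (\<lambda>t. Im (W t))"
        by (intro continuous_intros continuous_on_subset[OF cont]) auto
      then obtain q where q: "q \<in> {0..a}" "\<And>t. t \<in> {0..a} \<Longrightarrow> Im (W t) \<le> Im (W q)"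
        using continuous_attains_sup[of "{0..a}" "\<lambda>t. Im (W t)"] False by auto
      have "Im (W q) < r" using q(1) a by (intro \<tau>(3)) auto
      then have "\<forall>\<^sub>F m in sequentially. Im (W q) < \<rho> m" using \<rho>(1) by (intro order_tendstoD)
      with le show ?thesis
      proof eventually_elim
        case (elim m)
        show ?case
        proof (rule ccontr)
          assume "\<not> a < s m"
          then have "Im (W (s m)) \<le> Im (W q)" using s(1)[of m] by (intro q(2)) auto
          with elim show False by linarith
        qed
      qed
    qed
  qed
  then have "(\<lambda>m. W (s m)) \<longlonglongrightarrow> W \<tau>"
    using s(1) \<tau>(1) by (intro continuous_on_tendsto_compose[OF cont]) auto
  with s(2) show ?thesis by (rule that)
qed

section \<open>Brownian increments and almost sure statements\<close>

text \<open>
  A stopped walk overshoots by at most one truncated step.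
\<close>

lemma functional_walk_le:
  fixes \<phi> :: "complex \<Rightarrow> real"
  assumes add: "\<And>u v. \<phi> (u + v) = \<phi> u + \<phi> v" and le: "\<And>u. \<phi> u \<le> norm u" and \<phi>0: "\<phi> 0 = 0"
    and c: "0 \<le> c" "\<And>w. w \<notin> S \<Longrightarrow> \<phi> w < c"
    and \<eta>: "0 < \<eta>" "\<eta> < 1/2"
  shows "\<phi> (walk \<eta> S d k) \<le> c + 2 * \<eta>"
proof (induction k)
  case 0
  then show ?case using c \<eta> \<phi>0 by simp
next
  case (Suc k)
  show ?case
  proof (cases "walk \<eta> S d k \<in> S")
    case True
    then show ?thesis using Suc by simp
  next
    case False
    have "\<phi> (truncated_Ln \<eta> (d k / position d k)) \<le> 2 * \<eta>"
      using le[of "truncated_Ln \<eta> (d k / position d k)"] norm_truncated_Ln[of \<eta> "d k / position d k"] \<eta> by linarith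
    then show ?thesis using c(2)[OF False] False by (simp add: add)
  qed
qed

text \<open>
  Events such as hitting \<open>0\<close> involve uncountably many times and need not be measurable.  It
  suffices to cover them, up to a null set, by limits inferior of events of small probability.
\<close>

lemma (in prob_space) AE_not_if_eventually_small:
  assumes small: "\<And>\<epsilon>. 0 < \<epsilon> \<Longrightarrow> \<exists>A::nat \<Rightarrow> 'a set. (\<forall>n. A n \<in> events) \<and> (\<forall>n. prob (A n) \<le> \<epsilon>) \<and>
      (AE \<omega> in M. Q \<omega> \<longrightarrow> (\<forall>\<^sub>F n in sequentially. \<omega> \<in> A n))"
  shows "AE \<omega> in M. \<not> Q \<omega>"
proof -
  have "\<exists>L. L \<in> events \<and> prob L \<le> 1 / real (Suc m) \<and> (AE \<omega> in M. Q \<omega> \<longrightarrow> \<omega> \<in> L)" for m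
  proof -
    obtain A :: "nat \<Rightarrow> 'a set" where A: "\<And>n. A n \<in> events" "\<And>n. prob (A n) \<le> 1 / real (Suc m)"
      "AE \<omega> in M. Q \<omega> \<longrightarrow> (\<forall>\<^sub>F n in sequentially. \<omega> \<in> A n)"
      using small[of "1 / real (Suc m)"] by auto
    define C where "C k = (\<Inter>n\<in>{k..}. A n)" for k :: nat
    have C: "C k \<in> events" for k
      unfolding C_def using A(1) by (intro sets.countable_INT') auto
    have CA: "C k \<subseteq> A k" for k by (auto simp: C_def)
    have pC: "prob (C k) \<le> 1 / real (Suc m)" for k
      using finite_measure_mono[OF CA A(1), of k] A(2)[of k] by linarith
    have "incseq C" by (intro incseq_SucI) (auto simp: C_def)
    then have "(\<lambda>k. prob (C k)) \<longlonglongrightarrow> prob (\<Union>k. C k)"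
      using C by (intro finite_Lim_measure_incseq) auto
    then have "prob (\<Union>k. C k) \<le> 1 / real (Suc m)"
      by (rule LIMSEQ_le_const2) (use pC in auto)
    moreover have "AE \<omega> in M. Q \<omega> \<longrightarrow> \<omega> \<in> (\<Union>k. C k)"
      using A(3) by eventually_elim (auto simp: C_def eventually_sequentially)
    ultimately show ?thesis using C by (intro exI[of _ "\<Union>k. C k"]) auto
  qed
  then obtain L where L: "\<And>m. L m \<in> events" "\<And>m. prob (L m) \<le> 1 / real (Suc m)"
    "\<And>m::nat. AE \<omega> in M. Q \<omega> \<longrightarrow> \<omega> \<in> L m" by metis
  define N where "N = (\<Inter>m. L m)"
  have N: "N \<in> events" unfolding N_def using L(1) by auto
  have "prob N \<le> 1 / real (Suc m)" for m
  proof -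
    have "prob N \<le> prob (L m)" by (rule finite_measure_mono) (use L(1) in \<open>auto simp: N_def\<close>)
    then show ?thesis using L(2)[of m] by linarith
  qed
  then have "prob N \<le> 0"
    by (intro LIMSEQ_le_const[OF LIMSEQ_inverse_real_of_nat]) (auto simp: inverse_eq_divide)
  then have "prob N = 0" by (simp add: order_antisym)
  then have "AE \<omega> in M. \<omega> \<notin> N" using N by (simp add: prob_eq_0)
  moreover have "AE \<omega> in M. \<forall>m. Q \<omega> \<longrightarrow> \<omega> \<in> L m" by (intro AE_all_countable[THEN iffD2] allI L(3))
  ultimately show ?thesis by eventually_elim (auto simp: N_def)
qed

lemma normal_density_complex_radial:
  "normal_density 0 \<sigma> (Re z) * normal_density 0 \<sigma> (Im z) = normal_density 0 \<sigma> 0 * normal_density 0 \<sigma> (norm z)"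
proof -
  have "- (norm z)\<^sup>2 / (2 * \<sigma>\<^sup>2) = - (Re z)\<^sup>2 / (2 * \<sigma>\<^sup>2) + - (Im z)\<^sup>2 / (2 * \<sigma>\<^sup>2)"
    by (simp add: cmod_power2 add_divide_distrib diff_divide_distrib)
  then have "exp (- (norm z)\<^sup>2 / (2 * \<sigma>\<^sup>2)) =
      exp (- (Re z)\<^sup>2 / (2 * \<sigma>\<^sup>2)) * exp (- (Im z)\<^sup>2 / (2 * \<sigma>\<^sup>2))"
    by (simp only: exp_add)
  then show ?thesis by (simp add: normal_density_def)
qed

context prob_space
begin

lemma bm_incr_indep:
  assumes "planar_brownian_motion 1 B"
  shows "indep_vars (\<lambda>_. borel) (\<lambda>i \<omega>. grid_increment (\<lambda>t. B t \<omega>) n i) {..<K}"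
proof -
  have H: "indep_vars (\<lambda>_. borel) (\<lambda>i \<omega>. B (t (Suc i)) \<omega> - B (t i) \<omega>) {..<K}"
    if "0 \<le> t 0 \<and> (\<forall>i<K. t i < t (Suc i))" for t
    using assms that unfolding planar_brownian_motion_def by blast
  show ?thesis
    unfolding grid_increment_def by (rule H) (auto intro: divide_strict_right_mono)
qed

lemma bm_incr_distributed:
  assumes "planar_brownian_motion 1 B" "0 \<le> s" "s < t"
  shows "distributed M lborel (\<lambda>\<omega>. B t \<omega> - B s \<omega>)
    (\<lambda>z. ennreal (normal_density 0 (sqrt (t - s)) 0 * normal_density 0 (sqrt (t - s)) (norm z)))"
proof -
  note conj = assms(1)[unfolded planar_brownian_motion_def]
  show ?thesis
    using conj[THEN conjunct2, THEN conjunct2, THEN conjunct2, THEN conjunct2, rule_format, of s t] assms(2,3)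
    by (simp only: normal_density_complex_radial simp_thms)
qed

lemma bm_rv:
  assumes "planar_brownian_motion 1 B" "0 \<le> t" shows "random_variable borel (B t)"
  by (rule assms(1)[unfolded planar_brownian_motion_def, THEN conjunct1, rule_format, OF assms(2)])

lemma bm_walk_rv:
  assumes "planar_brownian_motion 1 B" "S \<in> sets borel" "\<eta> < 1"
  shows "random_variable borel (\<lambda>\<omega>. walk \<eta> S (grid_increment (\<lambda>t. B t \<omega>) n) k)"
proof (rule walk_measurable(1)[OF assms(3,2)])
  fix i :: nat
  show "(\<lambda>\<omega>. grid_increment (\<lambda>t. B t \<omega>) n i) \<in> borel_measurable M"
    unfolding grid_increment_def by (intro borel_measurable_diff bm_rv[OF assms(1)]) simp_all
qed

lemma bm_expectation_walk:
  fixes g :: "complex \<Rightarrow> complex"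
  assumes bm: "planar_brownian_motion 1 B"
    and \<eta>: "0 < \<eta>" "\<eta> < 1/4" and S: "S \<in> sets borel"
    and g: "g \<in> borel_measurable borel"
    and hol: "\<And>y. y \<notin> S \<Longrightarrow> g holomorphic_on ball y (4 * \<eta>)"
    and bdd: "\<And>k. \<exists>C. \<forall>d. norm (g (walk \<eta> S d k)) \<le> C"
  shows "integrable M (\<lambda>\<omega>. g (walk \<eta> S (grid_increment (\<lambda>t. B t \<omega>) n) k))"
    and "expectation (\<lambda>\<omega>. g (walk \<eta> S (grid_increment (\<lambda>t. B t \<omega>) n) k)) = g 0"
proof -
  note [measurable] = g bm_walk_rv[OF bm S, of \<eta>]
  obtain C where C: "\<And>d. norm (g (walk \<eta> S d k)) \<le> C" using bdd by blast
  have "\<eta> < 1" using \<eta> by simp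
  then show "integrable M (\<lambda>\<omega>. g (walk \<eta> S (grid_increment (\<lambda>t. B t \<omega>) n) k))"
    by (intro integrable_const_bound[where B=C]) (auto simp: C)
  define q where "q = (\<lambda>x. ennreal (normal_density 0 (sqrt (1 / 2 ^ n)) 0 * normal_density 0 (sqrt (1 / 2 ^ n)) x))"
  have "expectation (\<lambda>\<omega>. g (walk \<eta> S (\<lambda>i. grid_increment (\<lambda>t. B t \<omega>) n i) k)) = g 0"
  proof (rule expectation_walk[OF bm_incr_indep[OF bm], where p = "\<lambda>_. q" and K = k])
    fix i :: nat
    have "real (Suc i) / 2 ^ n - real i / 2 ^ n = 1 / 2 ^ n" by (simp add: field_simps)
    then show "distributed M lborel (\<lambda>\<omega>. grid_increment (\<lambda>t. B t \<omega>) n i) (\<lambda>z. q (norm z))"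
      using bm_incr_distributed[OF bm, of "real i / 2 ^ n" "real (Suc i) / 2 ^ n"]
      unfolding grid_increment_def q_def by (simp add: divide_strict_right_mono)
  qed (use assms in \<open>auto simp: q_def\<close>)
  then show "expectation (\<lambda>\<omega>. g (walk \<eta> S (grid_increment (\<lambda>t. B t \<omega>) n) k)) = g 0" by simp
qed

lemma prob_ge_le_expectation:
  fixes X :: "'a \<Rightarrow> real"
  assumes "integrable M X" "\<And>\<omega>. \<omega> \<in> space M \<Longrightarrow> 0 \<le> X \<omega>" "0 < a"
  shows "prob {\<omega> \<in> space M. a \<le> X \<omega>} \<le> expectation X / a"
  by (rule integral_Markov_inequality_measure[where A="{}"]) (use assms in auto)

end

section \<open>Brownian motion avoids the origin\<close>

context prob_space
begin

text \<open>
  The real part of the walk, stopped at \<open>- a\<close> and \<open>\<kappa>\<close>, has mean \<open>0\<close> and is at most \<open>\<kappa> + 1\<close>.  It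
  therefore ends below \<open>- a\<close> with probability at most \<open>(\<kappa> + 1) / a\<close>, uniformly in the mesh.
\<close>

lemma bm_nonzero:
  assumes bm: "planar_brownian_motion 1 B"
  shows "AE \<omega> in M. \<forall>t\<ge>0. B t \<omega> \<noteq> 0"
proof -
  define \<eta> where "\<eta> = (1/8 :: real)"
  have \<eta>: "0 < \<eta>" "\<eta> < 1/4" "\<eta> < 1/2" "\<eta> < 1" by (auto simp: \<eta>_def)
  have cont: "AE \<omega> in M. continuous_on {0..} (\<lambda>t. B t \<omega>)" and start: "AE \<omega> in M. B 0 \<omega> = 1"
    using bm unfolding planar_brownian_motion_def by auto
  define Q where "Q N K \<omega> \<longleftrightarrow> (\<exists>t0\<ge>0. t0 \<le> real N \<and> B t0 \<omega> = 0) \<and>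
      (\<forall>t. 0 \<le> t \<and> t \<le> real N \<longrightarrow> norm (B t \<omega>) \<le> real K)" for N K :: nat and \<omega>
  have "AE \<omega> in M. \<not> Q N K \<omega>" for N K
  proof (rule AE_not_if_eventually_small)
    fix \<epsilon> :: real assume \<epsilon>: "0 < \<epsilon>"
    define \<kappa> where "\<kappa> = real (Suc K)"
    define a where "a = (\<kappa> + 1) / \<epsilon>"
    have \<kappa>: "0 < \<kappa>" by (simp add: \<kappa>_def)
    have a: "0 < a" using \<epsilon> \<kappa> by (simp add: a_def)
    define S where "S = {w. Re w \<le> - a \<or> \<kappa> \<le> Re w}"
    have S: "S \<in> sets borel" unfolding S_def by measurable
    define Y where "Y n \<omega> = walk \<eta> S (grid_increment (\<lambda>t. B t \<omega>) n) (N * 2 ^ n)" for n \<omega>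
    have Ym [measurable]: "random_variable borel (Y n)" for n
      using bm_walk_rv[OF bm S \<eta>(4)] unfolding Y_def[abs_def] .
    have bdd: "\<exists>C. \<forall>d. norm (walk \<eta> S d k) \<le> C" for k
      using norm_walk_le[of \<eta> S _ k] \<eta> by (intro exI[of _ "2 * \<eta> * real k"]) auto
    have int: "integrable M (Y n)" and ex: "expectation (Y n) = 0" for n
      using bm_expectation_walk[OF bm \<eta>(1,2) S, of "\<lambda>z. z"] bdd unfolding Y_def[abs_def] 
      by (auto intro: holomorphic_intros)
    have up: "Re (Y n \<omega>) \<le> \<kappa> + 1" for n \<omega>
    proof -
      have "Re (Y n \<omega>) \<le> \<kappa> + 2 * \<eta>"
        unfolding Y_def using \<kappa> \<eta> by (intro functional_walk_le) (auto simp: complex_Re_le_cmod S_def)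
      then show ?thesis by (simp add: \<eta>_def)
    qed
    define A where "A n = {\<omega> \<in> space M. a \<le> \<kappa> + 1 - Re (Y n \<omega>)}" for n
    have "prob (A n) \<le> expectation (\<lambda>\<omega>. \<kappa> + 1 - Re (Y n \<omega>)) / a" for n
      unfolding A_def using int a up[of n] by (intro prob_ge_le_expectation) auto
    also have "expectation (\<lambda>\<omega>. \<kappa> + 1 - Re (Y n \<omega>)) / a = \<epsilon>" for n
      using int[of n] ex[of n] \<kappa> \<epsilon> by (simp add: prob_space a_def)
    finally have pA: "prob (A n) \<le> \<epsilon>" for n .
    have "AE \<omega> in M. Q N K \<omega> \<longrightarrow> (\<forall>\<^sub>F n in sequentially. \<omega> \<in> A n)"
      using cont start AE_space
    proof eventually_elim
      case (elim \<omega>)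
      show ?case
      proof
        assume Q: "Q N K \<omega>"
        then obtain t0 where t0: "0 \<le> t0" "t0 \<le> real N" "B t0 \<omega> = 0" by (auto simp: Q_def)
        have "norm (B t \<omega>) < exp \<kappa>" if "0 \<le> t" "t \<le> real N" for t
        proof -
          have "norm (B t \<omega>) \<le> real K" using Q that by (auto simp: Q_def)
          also have "\<dots> < 1 + \<kappa>" by (simp add: \<kappa>_def)
          also have "\<dots> \<le> exp \<kappa>" by (rule exp_ge_add_one_self)
          finally show ?thesis .
        qed
        from walk_detects_zero[OF elim(1,2) t0 \<kappa> this a \<eta>(1,4)]
        have "\<forall>\<^sub>F n in sequentially. Re (Y n \<omega>) \<le> - a" by (simp add: Y_def S_def)
        then show "\<forall>\<^sub>F n in sequentially. \<omega> \<in> A n"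
          by eventually_elim (use \<kappa> elim in \<open>auto simp: A_def\<close>)
      qed
    qed
    then show "\<exists>A::nat \<Rightarrow> 'a set. (\<forall>n. A n \<in> events) \<and> (\<forall>n. prob (A n) \<le> \<epsilon>) \<and>
      (AE \<omega> in M. Q N K \<omega> \<longrightarrow> (\<forall>\<^sub>F n in sequentially. \<omega> \<in> A n))"
      using pA by (intro exI[of _ A]) (auto simp: A_def)
  qed
  then have "AE \<omega> in M. \<forall>N K. \<not> Q N K \<omega>" by (simp add: AE_all_countable)
  then show ?thesis using cont
  proof eventually_elim
    case (elim \<omega>)
    show ?case
    proof (intro allI impI notI)
      fix t :: real assume t: "0 \<le> t" "B t \<omega> = 0"
      obtain N :: nat where N: "t \<le> real N" using real_arch_simple by blast
      have "compact ((\<lambda>t. B t \<omega>) ` {0..real N})"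
        by (intro compact_continuous_image continuous_on_subset[OF elim(2)]) auto
      then obtain C where C: "\<And>t. t \<in> {0..real N} \<Longrightarrow> norm (B t \<omega>) \<le> C"
        using compact_imp_bounded bounded_iff by (metis imageI)
      obtain K :: nat where K: "C \<le> real K" using real_arch_simple by blast
      have "norm (B t \<omega>) \<le> real K" if "0 \<le> t \<and> t \<le> real N" for t
        using C[of t] K that by auto
      then have "Q N K \<omega>" using t N by (auto simp: Q_def)
      with elim(1) show False by blast
    qed
  qed
qed

end

section \<open>Logarithmic test functions and the continuous logarithm of a path\<close>

text \<open>
  The default value \<open>0\<close> makes the restriction of \<open>Ln\<close> to the right half plane Borel measurable
  on the whole plane.
\<close>

definition half_plane_Ln :: "complex \<Rightarrow> complex \<Rightarrow> complex" where
  "half_plane_Ln \<zeta> w = (if 0 < Re (\<zeta> + \<i> * w) then Ln (\<zeta> + \<i> * w) else 0)"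

lemma open_half_plane_Ln_domain: "open {w. 0 < Re (\<zeta> + \<i> * w)}"
  by (intro open_Collect_less continuous_intros)

lemma holomorphic_half_plane_Ln: "half_plane_Ln \<zeta> holomorphic_on {w. 0 < Re (\<zeta> + \<i> * w)}"
proof -
  have "(\<lambda>w. Ln (\<zeta> + \<i> * w)) holomorphic_on {w. 0 < Re (\<zeta> + \<i> * w)}"
    by (intro holomorphic_intros) (auto simp: complex_nonpos_Reals_iff)
  then show ?thesis by (rule holomorphic_transform) (simp add: half_plane_Ln_def)
qed

lemma isCont_half_plane_Ln: "0 < Re (\<zeta> + \<i> * w) \<Longrightarrow> isCont (half_plane_Ln \<zeta>) w"
  using holomorphic_on_imp_continuous_on[OF holomorphic_half_plane_Ln] continuous_on_eq_continuous_at[OF open_half_plane_Ln_domain]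
  by blast

lemma half_plane_Ln_measurable [measurable]: "half_plane_Ln \<zeta> \<in> borel_measurable borel"
proof -
  have "(\<lambda>w. if w \<in> {w. 0 < Re (\<zeta> + \<i> * w)} then half_plane_Ln \<zeta> w else 0) \<in> borel_measurable borel"
    using open_half_plane_Ln_domain holomorphic_on_imp_continuous_on[OF holomorphic_half_plane_Ln]
    by (intro borel_measurable_continuous_on_if) auto
  also have "(\<lambda>w. if w \<in> {w. 0 < Re (\<zeta> + \<i> * w)} then half_plane_Ln \<zeta> w else 0) = half_plane_Ln \<zeta>"
    by (simp add: half_plane_Ln_def fun_eq_iff)
  finally show ?thesis .
qed

lemma abs_Im_half_plane_Ln_le: "\<bar>Im (half_plane_Ln \<zeta> w)\<bar> \<le> pi"
proof (cases "0 < Re (\<zeta> + \<i> * w)")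
  case True
  then have "\<zeta> + \<i> * w \<noteq> 0" by (metis less_irrefl zero_complex.sel(1))
  then show ?thesis
    using Im_Ln_le_pi[of "\<zeta> + \<i> * w"] mpi_less_Im_Ln[of "\<zeta> + \<i> * w"] by (auto simp: half_plane_Ln_def)
qed (simp add: half_plane_Ln_def)

lemma Im_walk_le:
  assumes "0 \<le> \<rho>" "0 < \<eta>" "\<eta> < 1/4"
  shows "Im (walk \<eta> {w. \<rho> \<le> Im w} d k) \<le> \<rho> + 2 * \<eta>"
  using assms abs_Im_le_cmod by (intro functional_walk_le) (auto intro: order_trans[OF abs_ge_self])

context prob_space
begin

text \<open>
  The condition on \<open>Re \<zeta>\<close> keeps \<open>\<zeta> + \<i> w\<close> in the right half plane along the stopped walk,
  overshoot included, and on the discs that the mean value property uses.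
\<close>

lemma bm_expectation_half_plane_Ln:
  assumes bm: "planar_brownian_motion 1 B"
    and \<eta>: "0 < \<eta>" "\<eta> < 1/4" and \<rho>: "0 \<le> \<rho>" "\<rho> + 4 * \<eta> \<le> Re \<zeta>"
  defines "Y \<equiv> \<lambda>n k \<omega>. walk \<eta> {w. \<rho> \<le> Im w} (grid_increment (\<lambda>t. B t \<omega>) n) k"
  shows "random_variable borel (Y n k)"
    and "2 * \<eta> \<le> Re (\<zeta> + \<i> * Y n k \<omega>)"
    and "integrable M (\<lambda>\<omega>. half_plane_Ln \<zeta> (Y n k \<omega>))"
    and "expectation (\<lambda>\<omega>. half_plane_Ln \<zeta> (Y n k \<omega>)) = Ln \<zeta>"
proof -
  define S where "S = {w. \<rho> \<le> Im w}"
  have S: "S \<in> sets borel" unfolding S_def by measurable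
  show "random_variable borel (Y n k)"
    unfolding Y_def S_def[symmetric] using \<eta> by (intro bm_walk_rv[OF bm S]) auto
  have Re_ge: "2 * \<eta> \<le> Re (\<zeta> + \<i> * walk \<eta> S d k)" for d k
    using Im_walk_le[OF \<rho>(1) \<eta>, of d k] \<rho> by (simp add: S_def)
  then show "2 * \<eta> \<le> Re (\<zeta> + \<i> * Y n k \<omega>)" by (simp only: Y_def S_def)
  have bdd: "\<exists>C. \<forall>d. norm (half_plane_Ln \<zeta> (walk \<eta> S d k)) \<le> C" for k
  proof -
    define R where "R = norm \<zeta> + 2 * \<eta> * real k"
    have "norm (half_plane_Ln \<zeta> (walk \<eta> S d k)) \<le> \<bar>ln (2 * \<eta>)\<bar> + \<bar>ln R\<bar> + pi" for d
    proof -
      define u where "u = \<zeta> + \<i> * walk \<eta> S d k"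
      have u: "2 * \<eta> \<le> Re u" using Re_ge by (simp only: u_def)
      have up: "norm u \<le> R"
        unfolding u_def R_def using norm_triangle_ineq[of \<zeta> "\<i> * walk \<eta> S d k"] norm_walk_le[of \<eta> S d k] \<eta>
        by (simp add: norm_mult)
      have lo: "2 * \<eta> \<le> norm u" using u complex_Re_le_cmod[of u] by linarith
      have "ln (2 * \<eta>) \<le> ln (norm u)" "ln (norm u) \<le> ln R"
        using up lo \<eta> by (auto intro!: ln_mono)
      moreover have "u \<noteq> 0" using lo \<eta> by auto
      moreover have "\<bar>Im (Ln u)\<bar> \<le> pi" using Im_Ln_le_pi[of u] mpi_less_Im_Ln[of u] \<open>u \<noteq> 0\<close> by auto
      ultimately have "norm (Ln u) \<le> \<bar>ln (2 * \<eta>)\<bar> + \<bar>ln R\<bar> + pi"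
        using cmod_le[of "Ln u"] by (simp add: Re_Ln)
      then show ?thesis using u \<eta> by (simp add: half_plane_Ln_def u_def)
    qed
    then show ?thesis by blast
  qed
  have hol: "half_plane_Ln \<zeta> holomorphic_on ball y (4 * \<eta>)" if "y \<notin> S" for y
  proof (rule holomorphic_on_subset[OF holomorphic_half_plane_Ln], safe)
    fix w assume "w \<in> ball y (4 * \<eta>)"
    then have "norm (w - y) < 4 * \<eta>" by (simp add: dist_norm norm_minus_commute)
    then have "Im w < Im y + 4 * \<eta>" using abs_Im_le_cmod[of "w - y"] by simp
    then show "0 < Re (\<zeta> + \<i> * w)" using that \<rho> by (simp add: S_def)
  qed
  show "integrable M (\<lambda>\<omega>. half_plane_Ln \<zeta> (Y n k \<omega>))"
    unfolding Y_def S_def[symmetric]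
    by (rule bm_expectation_walk(1)[OF bm \<eta> S half_plane_Ln_measurable]) (rule hol bdd, assumption?)+
  have "half_plane_Ln \<zeta> 0 = Ln \<zeta>" using \<rho> \<eta> by (simp add: half_plane_Ln_def)
  then show "expectation (\<lambda>\<omega>. half_plane_Ln \<zeta> (Y n k \<omega>)) = Ln \<zeta>"
    unfolding Y_def S_def[symmetric]
    by (subst bm_expectation_walk(2)[OF bm \<eta> S half_plane_Ln_measurable]) (rule hol bdd | assumption)+
qed

text \<open>
  The Gaussian density at time \<open>N\<close> is at most \<open>1 / N\<close>, so a fixed disc receives little mass.
\<close>

lemma bm_prob_near_start_small:
  assumes bm: "planar_brownian_motion 1 B" and "0 < \<epsilon>"
  shows "\<exists>N::nat. prob {\<omega> \<in> space M. norm (B (real N) \<omega> - B 0 \<omega>) \<le> R} \<le> \<epsilon>"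
proof -
  define V where "V = measure lborel (cball (0::complex) R)"
  have V: "emeasure lborel (cball (0::complex) R) = ennreal V" "0 \<le> V"
    unfolding V_def using emeasure_lborel_cball_finite[of "0::complex" R]
    by (auto simp: emeasure_eq_ennreal_measure)
  obtain N :: nat where N: "V / \<epsilon> + 1 \<le> real N" using real_arch_simple by blast
  have N0: "0 < real N" using N V \<open>0 < \<epsilon>\<close> divide_nonneg_pos[of V \<epsilon>] by linarith
  define \<Delta> where "\<Delta> = (\<lambda>\<omega>. B (real N) \<omega> - B 0 \<omega>)"
  define p where "p = (\<lambda>z::complex. ennreal (normal_density 0 (sqrt (real N)) 0 * normal_density 0 (sqrt (real N)) (norm z)))"
  have d: "distributed M lborel \<Delta> p"
    unfolding \<Delta>_def p_def using bm_incr_distributed[OF bm, of 0 "real N"] N0 by simp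
  have nd: "normal_density 0 (sqrt (real N)) x \<le> 1 / sqrt (2 * pi * real N)" for x
    using N0 unfolding normal_density_def by (simp add: divide_right_mono)
  have pb: "p z \<le> ennreal (1 / real N)" for z
  proof -
    have "normal_density 0 (sqrt (real N)) 0 * normal_density 0 (sqrt (real N)) (norm z)
        \<le> 1 / sqrt (2 * pi * real N) * (1 / sqrt (2 * pi * real N))"
      by (intro mult_mono nd) auto
    also have "\<dots> = 1 / (2 * pi * real N)" using N0 by simp
    also have "\<dots> \<le> 1 / real N"
      using N0 pi_ge_two by (intro divide_left_mono) auto
    finally show ?thesis unfolding p_def by (rule ennreal_leI)
  qed
  have "emeasure M (\<Delta> -` cball 0 R \<inter> space M) = (\<integral>\<^sup>+z. p z * indicator (cball 0 R) z \<partial>lborel)"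
    by (rule distributed_emeasure[OF d]) simp
  also have "\<dots> \<le> (\<integral>\<^sup>+z. ennreal (1 / real N) * indicator (cball (0::complex) R) z \<partial>lborel)"
    by (intro nn_integral_mono mult_right_mono pb) auto
  also have "\<dots> = ennreal (1 / real N * V)"
  proof -
    have eq: "ennreal (1 / real N * V) = ennreal (1 / real N) * ennreal V"
      using V(2) by (intro ennreal_mult) auto
    show ?thesis unfolding eq V(1)[symmetric] by (rule nn_integral_cmult_indicator) simp
  qed
  also have "\<dots> \<le> ennreal \<epsilon>"
  proof (rule ennreal_leI)
    have "V / \<epsilon> \<le> real N" using N by simp
    then show "1 / real N * V \<le> \<epsilon>" using \<open>0 < \<epsilon>\<close> N0 by (simp add: field_simps)
  qed
  finally have "prob (\<Delta> -` cball 0 R \<inter> space M) \<le> \<epsilon>"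
    using \<open>0 < \<epsilon>\<close> by (simp add: emeasure_eq_measure)
  moreover have "\<Delta> -` cball 0 R \<inter> space M = {\<omega> \<in> space M. norm (B (real N) \<omega> - B 0 \<omega>) \<le> R}"
    by (auto simp: \<Delta>_def)
  ultimately show ?thesis by auto
qed

end

text \<open>
  The chosen argument is reused as imaginary part, so that hitting an angle
  becomes hitting a horizontal line by a continuous logarithm.
\<close>

definition logpath :: "(real \<Rightarrow> complex) \<Rightarrow> real \<Rightarrow> complex" where
  "logpath \<gamma> t = Complex (ln (norm (\<gamma> t))) (continuous_arg \<gamma> t)"

lemma logpath:
  assumes cont: "continuous_on {0..} \<gamma>" and \<gamma>0: "\<gamma> 0 = 1" and nz: "\<And>t. 0 \<le> t \<Longrightarrow> \<gamma> t \<noteq> 0"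
  shows "continuous_on {0..} (logpath \<gamma>)" "logpath \<gamma> 0 = 0" "\<And>t. 0 \<le> t \<Longrightarrow> \<gamma> t = exp (logpath \<gamma> t)"
proof -
  have "contractible {0::real..}" by (simp add: convex_imp_contractible)
  then obtain g where g: "continuous_on {0..} g" "\<And>t. t \<in> {0..} \<Longrightarrow> \<gamma> t = exp (g t)"
    using continuous_logarithm_on_contractible[OF cont] nz by auto
  have "exp (g 0) = 1" using g(2)[of 0] \<gamma>0 by simp
  define \<theta> where "\<theta> t = Im (g t - g 0)" for t
  have "continuous_on {0..} \<theta> \<and> \<theta> 0 = 0 \<and> (\<forall>t\<ge>0. is_Arg (\<gamma> t) (\<theta> t))"
  proof (intro conjI allI impI)
    show "continuous_on {0..} \<theta>" unfolding \<theta>_def by (intro continuous_intros g)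
    show "\<theta> 0 = 0" by (simp add: \<theta>_def)
    fix t :: real assume "0 \<le> t"
    then have "\<gamma> t = exp (g t - g 0)" using g(2)[of t] \<open>exp (g 0) = 1\<close> by (simp add: exp_diff)
    also have "\<dots> = of_real (norm (exp (g t - g 0))) * exp (\<i> * of_real (\<theta> t))"
      unfolding \<theta>_def norm_exp_eq_Re cis_conv_exp[symmetric] by (rule exp_eq_polar)
    finally show "is_Arg (\<gamma> t) (\<theta> t)"
      unfolding is_Arg_def by (simp only: \<open>\<gamma> t = exp (g t - g 0)\<close>)
  qed
  then have ex: "\<exists>\<theta>. continuous_on {0..} \<theta> \<and> \<theta> 0 = 0 \<and> (\<forall>t\<ge>0. is_Arg (\<gamma> t) (\<theta> t))"
    by (intro exI[of _ \<theta>])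
  note some = someI_ex[OF ex, folded continuous_arg_def]
  note arg = some[THEN conjunct1] some[THEN conjunct2, THEN conjunct1]
    some[THEN conjunct2, THEN conjunct2, rule_format]
  show "continuous_on {0..} (logpath \<gamma>)"
    unfolding logpath_def[abs_def] Complex_eq by (intro continuous_intros cont arg) (use nz in auto)
  show "logpath \<gamma> 0 = 0" by (simp add: logpath_def \<gamma>0 arg complex_eq_iff)
  fix t :: real assume t: "0 \<le> t"
  show "\<gamma> t = exp (logpath \<gamma> t)"
    using arg(3)[OF t] nz[OF t] exp_eq_polar[of "logpath \<gamma> t"]
    by (simp add: logpath_def is_Arg_def cis_conv_exp)
qed

section \<open>Every positive angle is reached\<close>

context prob_space
begin

text \<open>
  If the angle \<open>r\<close> is never reached, the walk stopped at height \<open>r\<close> ends at \<open>W N\<close> for every fine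
  mesh, and \<open>\<bar>c + \<i> W N\<bar> \<ge> ln \<bar>B N\<bar>\<close>.  The mean of \<open>ln \<bar>c + \<i> w\<bar>\<close> is \<open>ln c\<close>, so this quantity
  cannot be large with high probability, although \<open>\<bar>B N\<bar>\<close> is.
\<close>

lemma bm_hits_level:
  assumes bm: "planar_brownian_motion 1 B" and r: "0 < r"
  shows "AE \<omega> in M. \<exists>t\<ge>0. continuous_arg (\<lambda>t. B t \<omega>) t = r"
proof -
  define \<eta> where "\<eta> = (1/8 :: real)"
  define c where "c = r + 2"
  have \<eta>: "0 < \<eta>" "\<eta> < 1/4" by (auto simp: \<eta>_def)
  have c: "0 \<le> r" "r + 4 * \<eta> \<le> Re (of_real c)" "1 < c" using r by (auto simp: c_def \<eta>_def)
  have cont: "AE \<omega> in M. continuous_on {0..} (\<lambda>t. B t \<omega>)" and start: "AE \<omega> in M. B 0 \<omega> = 1"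
    using bm unfolding planar_brownian_motion_def by auto
  note nonzero = bm_nonzero[OF bm]
  let ?S = "{w. r \<le> Im w}"
  define Q where "Q \<omega> \<longleftrightarrow> \<not> (\<exists>t\<ge>0. continuous_arg (\<lambda>t. B t \<omega>) t = r)" for \<omega>
  have "AE \<omega> in M. \<not> Q \<omega>"
  proof (rule AE_not_if_eventually_small)
    fix \<epsilon> :: real assume \<epsilon>: "0 < \<epsilon>"
    define L where "L = 2 * ln c / \<epsilon>"
    have L: "0 < L" using \<epsilon> c by (simp add: L_def)
    \<comment> \<open>one exponential from \<open>Re W = ln \<bar>B N\<bar>\<close>, the other from the outer logarithm\<close>
    define K where "K = exp (exp L)"
    obtain N :: nat where N: "prob {\<omega> \<in> space M. norm (B (real N) \<omega> - B 0 \<omega>) \<le> K + 1} \<le> \<epsilon> / 2"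
      using bm_prob_near_start_small[OF bm, of "\<epsilon> / 2" "K + 1"] \<epsilon> by auto
    define E where "E = {\<omega> \<in> space M. norm (B (real N) \<omega> - B 0 \<omega>) \<le> K + 1}"
    have E: "E \<in> events"
      unfolding E_def using bm_rv[OF bm, of "real N"] bm_rv[OF bm, of 0] by measurable
    define Y where "Y n \<omega> = walk \<eta> ?S (grid_increment (\<lambda>t. B t \<omega>) n) (N * 2 ^ n)" for n \<omega>
    have Ym [measurable]: "random_variable borel (Y n)" for n
      unfolding Y_def[abs_def] by (rule bm_expectation_half_plane_Ln(1)[OF bm \<eta> c(1,2)])
    have Re_half_plane_Ln: "0 \<le> Re (half_plane_Ln (of_real c) (Y n \<omega>))" for n \<omega>
    proof -
      have "Im (Y n \<omega>) \<le> r + 2 * \<eta>"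
        unfolding Y_def by (rule Im_walk_le[OF c(1) \<eta>])
      then have u: "1 \<le> Re (of_real c + \<i> * Y n \<omega>)" by (simp add: c_def \<eta>_def)
      then have "1 \<le> norm (of_real c + \<i> * Y n \<omega>)" using complex_Re_le_cmod order_trans by blast
      moreover from this have "of_real c + \<i> * Y n \<omega> \<noteq> 0" by auto
      ultimately show ?thesis using u by (simp add: half_plane_Ln_def Re_Ln)
    qed
    have int: "integrable M (\<lambda>\<omega>. half_plane_Ln (of_real c) (Y n \<omega>))"
      and ex: "expectation (\<lambda>\<omega>. half_plane_Ln (of_real c) (Y n \<omega>)) = of_real (ln c)" for n
      using bm_expectation_half_plane_Ln(3,4)[OF bm \<eta> c(1,2), of n "N * 2 ^ n"] c
      unfolding Y_def by (auto simp: Ln_of_real)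
    define A where "A n = {\<omega> \<in> space M. L \<le> Re (half_plane_Ln (of_real c) (Y n \<omega>))} \<union> E" for n
    have A: "A n \<in> events" for n unfolding A_def using E by measurable
    have "prob (A n) \<le> \<epsilon>" for n
    proof -
      have "prob {\<omega> \<in> space M. L \<le> Re (half_plane_Ln (of_real c) (Y n \<omega>))} \<le> expectation (\<lambda>\<omega>. Re (half_plane_Ln (of_real c) (Y n \<omega>))) / L"
        using int[of n] L Re_half_plane_Ln by (intro prob_ge_le_expectation) auto
      also have "\<dots> = \<epsilon> / 2" using int[of n] ex[of n] c \<epsilon> by (simp add: L_def)
      finally have "prob {\<omega> \<in> space M. L \<le> Re (half_plane_Ln (of_real c) (Y n \<omega>))} \<le> \<epsilon> / 2" .
      moreover have "prob (A n) \<le> prob {\<omega> \<in> space M. L \<le> Re (half_plane_Ln (of_real c) (Y n \<omega>))} + prob E"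
        unfolding A_def using E by (intro measure_Un_le) measurable
      ultimately show ?thesis using N by (simp add: E_def)
    qed
    moreover have "AE \<omega> in M. Q \<omega> \<longrightarrow> (\<forall>\<^sub>F n in sequentially. \<omega> \<in> A n)"
      using cont start nonzero AE_space
    proof eventually_elim
      case (elim \<omega>)
      show ?case
      proof
        assume Q: "Q \<omega>"
        define W where "W = logpath (\<lambda>t. B t \<omega>)"
        have nz: "\<And>t. 0 \<le> t \<Longrightarrow> B t \<omega> \<noteq> 0" using elim(3) by simp
        have W: "continuous_on {0..} W" "W 0 = 0" "\<And>t. 0 \<le> t \<Longrightarrow> B t \<omega> = exp (W t)"
          unfolding W_def by (rule logpath[OF elim(1,2) nz], assumption)+
        have ne: "Im (W t) \<noteq> r" if "0 \<le> t" for t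
          using Q that by (auto simp: Q_def W_def logpath_def)
        have below: "Im (W t) < r" if t: "0 \<le> t" for t
        proof (rule ccontr)
          assume "\<not> Im (W t) < r"
          moreover have "continuous_on {0..t} (\<lambda>t. Im (W t))"
            by (intro continuous_intros continuous_on_subset[OF W(1)]) auto
          ultimately obtain x where "0 \<le> x" "x \<le> t" "Im (W x) = r"
            using IVT'[of "\<lambda>t. Im (W t)" 0 r t] W(2) r t by auto
          then show False using ne by blast
        qed
        show "\<forall>\<^sub>F n in sequentially. \<omega> \<in> A n"
        proof (cases "\<omega> \<in> E")
          case True
          then show ?thesis by (simp add: A_def)
        next
          case False
          then have "K + 1 < norm (B (real N) \<omega> - 1)" using elim by (simp add: E_def)
          also have "\<dots> \<le> norm (B (real N) \<omega>) + 1" using norm_triangle_ineq4[of "B (real N) \<omega>" 1] by simp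
          finally have "K \<le> norm (B (real N) \<omega>)" by simp
          also have "\<dots> = exp (Re (W (real N)))" using W(3)[of "real N"] by (simp add: norm_exp_eq_Re)
          finally have "exp L \<le> Re (W (real N))" by (simp add: K_def)
          moreover have "Im (of_real c + \<i> * W (real N)) = Re (W (real N))" by simp
          ultimately have big: "exp L \<le> norm (of_real c + \<i> * W (real N))"
            using abs_Im_le_cmod[of "of_real c + \<i> * W (real N)"] by linarith
          have "0 < Re (of_real c + \<i> * W (real N))" using below[of "real N"] by (simp add: c_def)
          moreover have "of_real c + \<i> * W (real N) \<noteq> 0" using big by auto
          moreover have "L \<le> ln (norm (of_real c + \<i> * W (real N)))"
            using big by (metis exp_gt_zero ln_exp ln_mono)
          ultimately have "L \<le> Re (half_plane_Ln (of_real c) (W (real N)))" by (simp add: half_plane_Ln_def Re_Ln)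
          moreover have "W t \<notin> ?S" if "0 \<le> t" for t using below[OF that] by simp
          then have "\<forall>\<^sub>F n in sequentially. Y n \<omega> = W (real N)"
            unfolding Y_def by (intro walk_eq_log_if_avoids W \<eta>(1))
          ultimately show ?thesis using elim(4) by (auto simp: A_def elim: eventually_mono)
        qed
      qed
    qed
    ultimately show "\<exists>A::nat \<Rightarrow> 'a set. (\<forall>n. A n \<in> events) \<and> (\<forall>n. prob (A n) \<le> \<epsilon>) \<and>
      (AE \<omega> in M. Q \<omega> \<longrightarrow> (\<forall>\<^sub>F n in sequentially. \<omega> \<in> A n))"
      using A by blast
  qed
  then show ?thesis by (simp add: Q_def)
qed

end

section \<open>The Cauchy law and its image on the ray\<close>

text \<open>
  As \<open>s \<rightarrow> 0\<close>, \<open>arctan ((X - b) / s)\<close> tends to \<open>pi / 2 * sgn (X - b)\<close>.  The resulting formula for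
  the mean of \<open>sgn (X - b)\<close> is continuous in \<open>b\<close>, which excludes atoms.
\<close>

lemma (in prob_space) cauchy_tail:
  assumes X [measurable]: "random_variable borel X" and r: "0 < r"
    and H: "\<And>s b. 0 < s \<Longrightarrow> expectation (\<lambda>\<omega>. arctan ((X \<omega> - b) / s)) = - arctan (b / (s + r))"
  shows "prob {\<omega> \<in> space M. x < X \<omega>} = 1/2 - arctan (x / r) / pi"
proof -
  have sg [measurable]: "(\<lambda>\<omega>. sgn (X \<omega> - b)) \<in> borel_measurable M" for b
    unfolding sgn_if by measurable
  have isg: "integrable M (\<lambda>\<omega>. sgn (X \<omega> - b))" for b
    by (rule integrable_const_bound[where B=1]) (auto simp: sgn_if)
  have E: "expectation (\<lambda>\<omega>. sgn (X \<omega> - b)) = - 2 / pi * arctan (b / r)" for b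
  proof -
    have lim: "(\<lambda>n. expectation (\<lambda>\<omega>. arctan ((X \<omega> - b) / (1 / real (Suc n))))) \<longlonglongrightarrow>
        expectation (\<lambda>\<omega>. pi / 2 * sgn (X \<omega> - b))"
    proof (rule integral_dominated_convergence[where w="\<lambda>_. pi / 2"])
      show "AE \<omega> in M. (\<lambda>n. arctan ((X \<omega> - b) / (1 / real (Suc n)))) \<longlonglongrightarrow> pi / 2 * sgn (X \<omega> - b)"
      proof (rule AE_I2)
        fix \<omega>
        have r: "filterlim (\<lambda>n. real (Suc n)) at_top sequentially"
          by (rule filterlim_compose[OF filterlim_real_sequentially filterlim_Suc])
        consider "X \<omega> - b = 0" | "X \<omega> - b > 0" | "X \<omega> - b < 0" by linarith
        then show "(\<lambda>n. arctan ((X \<omega> - b) / (1 / real (Suc n)))) \<longlonglongrightarrow> pi / 2 * sgn (X \<omega> - b)"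
        proof cases
          case 2
          have "filterlim (\<lambda>n. (X \<omega> - b) * real (Suc n)) at_top sequentially"
            by (rule filterlim_tendsto_pos_mult_at_top[OF tendsto_const 2 r])
          from filterlim_compose[OF tendsto_arctan_at_top this] 2
          show ?thesis by simp
        next
          case 3
          have "filterlim (\<lambda>n. (X \<omega> - b) * real (Suc n)) at_bot sequentially"
            by (rule filterlim_tendsto_neg_mult_at_bot[OF tendsto_const 3 r])
          from filterlim_compose[OF tendsto_arctan_at_bot this] 3
          show ?thesis by simp
        qed simp
      qed
      show "AE \<omega> in M. norm (arctan ((X \<omega> - b) / (1 / real (Suc n)))) \<le> pi / 2" for n
      proof (rule AE_I2)
        fix \<omega>
        show "norm (arctan ((X \<omega> - b) / (1 / real (Suc n)))) \<le> pi / 2"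
          using arctan_bounded[of "(X \<omega> - b) / (1 / real (Suc n))"] by (simp only: real_norm_def) linarith
      qed
    qed (auto simp: borel_measurable_arctan)
    have "(\<lambda>n. - arctan (b / (1 / real (Suc n) + r))) \<longlonglongrightarrow> - arctan (b / (0 + r))"
      using LIMSEQ_inverse_real_of_nat r
      by (intro tendsto_minus tendsto_arctan tendsto_divide tendsto_add tendsto_const) (auto simp: inverse_eq_divide)
    moreover have "expectation (\<lambda>\<omega>. arctan ((X \<omega> - b) / (1 / real (Suc n)))) = - arctan (b / (1 / real (Suc n) + r))" for n
      by (rule H) simp
    ultimately have "expectation (\<lambda>\<omega>. pi / 2 * sgn (X \<omega> - b)) = - arctan (b / r)"
      using LIMSEQ_unique[OF lim] by simp
    then show ?thesis by (simp add: field_simps)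
  qed
  define P where "P = prob {\<omega> \<in> space M. x < X \<omega>}"
  have ind: "expectation (indicator {\<omega> \<in> space M. x < X \<omega>}) = P"
    unfolding P_def by simp
  have iind: "integrable M (indicator {\<omega> \<in> space M. x < X \<omega>} :: 'a \<Rightarrow> real)"
    by (rule integrable_const_bound[where B=1]) (auto simp: indicator_def)
  have "expectation (\<lambda>\<omega>. 2 * indicator {\<omega> \<in> space M. x < X \<omega>} \<omega>) \<le> expectation (\<lambda>\<omega>. 1 + sgn (X \<omega> - x))"
  proof (rule integral_mono)
    show "2 * indicator {\<omega> \<in> space M. x < X \<omega>} \<omega> \<le> 1 + sgn (X \<omega> - x)" for \<omega>
      by (auto simp: indicator_def sgn_if)
  qed (use isg[of x] iind in simp_all)
  then have up: "2 * P \<le> 1 - 2 / pi * arctan (x / r)"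
    using isg[of x] E[of x] ind by (simp add: prob_space)
  \<comment> \<open>a slightly larger threshold \<open>b\<close> absorbs a possible atom at \<open>x\<close>\<close>
  have lo: "1 - 2 / pi * arctan (b / r) \<le> 2 * P" if "x < b" for b
  proof -
    have "expectation (\<lambda>\<omega>. 1 + sgn (X \<omega> - b)) \<le> expectation (\<lambda>\<omega>. 2 * indicator {\<omega> \<in> space M. x < X \<omega>} \<omega>)"
    proof (rule integral_mono)
      show "1 + sgn (X \<omega> - b) \<le> 2 * indicator {\<omega> \<in> space M. x < X \<omega>} \<omega>" if "\<omega> \<in> space M" for \<omega>
        using that \<open>x < b\<close> by (auto simp: indicator_def sgn_if)
    qed (use isg[of b] iind in simp_all)
    then show ?thesis using isg[of b] E[of b] ind by (simp add: prob_space)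
  qed
  have "(\<lambda>n. 1 - 2 / pi * arctan ((x + inverse (real (Suc n))) / r)) \<longlonglongrightarrow> 1 - 2 / pi * arctan ((x + 0) / r)"
    using LIMSEQ_inverse_real_of_nat r by (intro tendsto_intros) auto
  then have "1 - 2 / pi * arctan ((x + 0) / r) \<le> 2 * P"
    by (rule LIMSEQ_le_const2) (use lo in auto)
  with up show ?thesis by (simp add: P_def field_simps)
qed

definition exp_cauchy_density :: "real \<Rightarrow> real \<Rightarrow> real" where
  "exp_cauchy_density r y = 1 / (pi * y) * (r / (r\<^sup>2 + (ln y)\<^sup>2))"

lemma exp_cauchy_density_measurable [measurable]: "exp_cauchy_density r \<in> borel_measurable borel"
  unfolding exp_cauchy_density_def by measurable

lemma nn_integral_exp_cauchy_density_tail: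
  assumes r: "0 < r" and x: "0 < x"
  shows "(\<integral>\<^sup>+y. ennreal (exp_cauchy_density r y) * indicator {x<..} y \<partial>lborel) = ennreal (1/2 - arctan (ln x / r) / pi)"
proof -
  have "(\<integral>\<^sup>+y. ennreal (exp_cauchy_density r y) * indicator {x<..} y \<partial>lborel) = (\<integral>\<^sup>+y. ennreal (exp_cauchy_density r y) * indicator {x..} y \<partial>lborel)"
    by (rule nn_integral_cong_AE) (use AE_lborel_singleton[of x] in \<open>auto simp: indicator_def\<close>)
  also have "\<dots> = ennreal (pi / 2 / pi - arctan (ln x / r) / pi)"
  proof (rule nn_integral_FTC_atLeast)
    fix y assume "x \<le> y"
    then have y: "0 < y" using x by simp
    have nz: "r\<^sup>2 + (ln y)\<^sup>2 \<noteq> 0" using r by (simp add: sum_power2_eq_zero_iff)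
    have nz': "1 + (ln y / r)\<^sup>2 = (r\<^sup>2 + (ln y)\<^sup>2) / r\<^sup>2" using r by (simp add: field_simps)
    show "((\<lambda>y. arctan (ln y / r) / pi) has_real_derivative exp_cauchy_density r y) (at y)"
      using y r nz unfolding exp_cauchy_density_def
      by (auto intro!: derivative_eq_intros simp: nz' power2_eq_square divide_simps)
    show "0 \<le> exp_cauchy_density r y" using y r by (simp add: exp_cauchy_density_def)
  next
    have "filterlim (\<lambda>y. ln y / r) at_top at_top"
      using filterlim_tendsto_pos_mult_at_top[OF tendsto_const _ ln_at_top, of "1 / r"] r by simp
    from filterlim_compose[OF tendsto_arctan_at_top this]
    show "((\<lambda>y. arctan (ln y / r) / pi) \<longlongrightarrow> pi / 2 / pi) at_top"
      by (intro tendsto_divide tendsto_const) auto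
  qed simp
  finally show ?thesis by simp
qed

text \<open>
  Reduces the tails of a measure on the positive half line to those at positive levels, where
  the density has a smooth primitive.
\<close>

lemma emeasure_tail_from_positive:
  fixes N :: "real measure"
  assumes [simp]: "sets N = sets borel" and null: "emeasure N {..0} = 0" and x: "x \<le> 0"
  shows "emeasure N {x<..} = (SUP n. emeasure N {1 / real (Suc n)<..})"
proof -
  have "emeasure N {x<..} = emeasure N ({0<..} \<union> ({x<..} \<inter> {..0}))"
    using x by (intro arg_cong[where f="emeasure N"]) auto
  also have "\<dots> = emeasure N {0<..}"
  proof (rule emeasure_Un_null_set)
    show "{x<..} \<inter> {..0} \<in> null_sets N"
      by (rule null_sets_subset[of "{..0}"]) (use null in \<open>auto simp: null_sets_def\<close>)
  qed simp
  also have "{0<..} = (\<Union>n. {1 / real (Suc n)<..})"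
  proof safe
    fix y :: real assume "0 < y"
    then obtain n where "inverse (real (Suc n)) < y" using reals_Archimedean by blast
    then show "y \<in> (\<Union>n. {1 / real (Suc n)<..})" by (auto simp: inverse_eq_divide)
  next
    fix y :: real and n :: nat assume "1 / real (Suc n) < y"
    moreover have "0 < 1 / real (Suc n)" by simp
    ultimately show "0 < y" by linarith
  qed
  also have "emeasure N (\<Union>n. {1 / real (Suc n)<..}) = (SUP n. emeasure N {1 / real (Suc n)<..})"
  proof (rule SUP_emeasure_incseq[symmetric])
    show "incseq (\<lambda>n. {1 / real (Suc n)<..})"
    proof (rule incseq_SucI)
      fix n
      have "1 / real (Suc (Suc n)) \<le> 1 / real (Suc n)" by (intro divide_left_mono) auto
      then show "{1 / real (Suc n)<..} \<subseteq> {1 / real (Suc (Suc n))<..}" by auto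
    qed
  qed auto
  finally show ?thesis .
qed

lemma (in prob_space) distr_exp_cauchy:
  assumes X [measurable]: "random_variable borel X" and r: "0 < r"
    and tail: "\<And>x. prob {\<omega> \<in> space M. x < X \<omega>} = 1/2 - arctan (x / r) / pi"
  shows "distr M borel (\<lambda>\<omega>. exp (X \<omega>)) = density lborel (\<lambda>y. ennreal (exp_cauchy_density r y) * indicator {0<..} y)"
proof -
  define L where "L = distr M borel (\<lambda>\<omega>. exp (X \<omega>))"
  define R where "R = density lborel (\<lambda>y. ennreal (exp_cauchy_density r y) * indicator {0<..} y)"
  interpret L: prob_space L unfolding L_def by (rule prob_space_distr) simp
  have positive_tail: "emeasure L {x<..} = emeasure R {x<..}" if x: "0 < x" for x
  proof -
    have "(\<lambda>\<omega>. exp (X \<omega>)) -` {x<..} \<inter> space M = {\<omega> \<in> space M. ln x < X \<omega>}"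
      using exp_less_cancel_iff[of "ln x"] x by auto
    then have "emeasure L {x<..} = ennreal (1/2 - arctan (ln x / r) / pi)"
      unfolding L_def using tail[of "ln x"] by (simp add: emeasure_distr emeasure_eq_measure)
    also have "\<dots> = (\<integral>\<^sup>+y. ennreal (exp_cauchy_density r y) * indicator {x<..} y \<partial>lborel)"
      by (rule nn_integral_exp_cauchy_density_tail[OF r x, symmetric])
    also have "\<dots> = emeasure R {x<..}"
      unfolding R_def by (subst emeasure_density) (use x in \<open>auto intro!: nn_integral_cong simp: indicator_def\<close>)
    finally show ?thesis .
  qed
  have "(\<lambda>\<omega>. exp (X \<omega>)) -` {..0} \<inter> space M = {}" by (auto simp: not_le)
  then have L0: "emeasure L {..0} = 0" unfolding L_def by (simp add: emeasure_distr)
  have "emeasure R {..0} = (\<integral>\<^sup>+y. ennreal (exp_cauchy_density r y) * indicator {0<..} y * indicator {..0} y \<partial>lborel)"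
    by (simp add: R_def emeasure_density)
  also have "\<dots> = (\<integral>\<^sup>+y. 0 \<partial>(lborel :: real measure))"
    by (rule nn_integral_cong) (simp add: indicator_def)
  finally have R0: "emeasure R {..0} = 0" by simp
  have "L = R"
  proof (rule measure_eqI_lessThan)
    show "emeasure L {x<..} = emeasure R {x<..}" for x
    proof (cases "0 < x")
      case False
      have "emeasure L {x<..} = (SUP n. emeasure L {1 / real (Suc n)<..})"
        by (rule emeasure_tail_from_positive[OF _ L0]) (use False in \<open>auto simp: L_def\<close>)
      also have "\<dots> = (SUP n. emeasure R {1 / real (Suc n)<..})" using positive_tail by simp
      also have "\<dots> = emeasure R {x<..}"
        by (rule emeasure_tail_from_positive[OF _ R0, symmetric]) (use False in \<open>auto simp: R_def\<close>)
      finally show ?thesis .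
    qed (rule positive_tail)
    show "emeasure L {x<..} < \<infinity>" for x by (simp add: L.emeasure_eq_measure)
  qed (simp_all add: L_def R_def)
  then show ?thesis by (simp only: L_def R_def)
qed

text \<open>
  The hitting point need only agree almost everywhere with a measurable function; the
  completion makes it measurable.
\<close>

lemma distributed_ray:
  fixes M :: "'a measure" and H :: "'a \<Rightarrow> complex"
  assumes V [measurable]: "V \<in> borel_measurable M"
    and HV: "AE \<omega> in M. H \<omega> = of_real (V \<omega>) * cis r"
    and distr: "distr M borel V = density lborel (\<lambda>y. ennreal (f y) * indicator {0<..} y)"
    and f [measurable]: "f \<in> borel_measurable borel"
  shows "distributed (completion M) (ray_arclength r) H (\<lambda>z. ennreal (f (norm z)))"
proof -
  define K where "K = (\<lambda>\<omega>. of_real (V \<omega>) * cis r)"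
  have [measurable]: "(\<lambda>y::real. of_real y * cis r) \<in> borel_measurable borel" by measurable
  have rest [measurable]: "(\<lambda>y::real. of_real y * cis r) \<in> restrict_space lborel {0<..} \<rightarrow>\<^sub>M borel"
    by (rule measurable_restrict_space1) simp
  have sets [measurable_cong, simp]: "sets (ray_arclength r) = sets borel" by (simp add: ray_arclength_def)
  have K [measurable]: "K \<in> borel_measurable M" unfolding K_def by measurable
  have KC: "K \<in> borel_measurable (completion M)" by (rule measurable_completion[OF K])
  have AE: "AE \<omega> in completion M. K \<omega> = H \<omega>"
    using AE_completion[OF HV] by eventually_elim (simp add: K_def)
  have HC: "H \<in> borel_measurable (completion M)"
  proof (rule measurableI)
    fix A :: "complex set" assume "A \<in> sets borel"
    then have KA: "K -` A \<inter> space (completion M) \<in> sets (completion M)" by (rule measurable_sets[OF KC])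
    have "AE \<omega> in completion M. \<omega> \<in> K -` A \<inter> space (completion M) \<longleftrightarrow> \<omega> \<in> H -` A \<inter> space (completion M)"
      using AE by eventually_elim simp
    then show "H -` A \<inter> space (completion M) \<in> sets (completion M)"
      by (rule completion.in_sets_AE[OF _ KA Int_lower2])
  qed simp
  have HR: "H \<in> completion M \<rightarrow>\<^sub>M ray_arclength r"
    by (subst measurable_cong_sets[OF refl sets]) (rule HC)
  have "distr (completion M) (ray_arclength r) H = distr (completion M) borel K"
  proof (rule distr_cong_AE[OF refl sets _ HR KC])
    show "AE \<omega> in completion M. H \<omega> = K \<omega>" using AE by eventually_elim simp
  qed
  also have "\<dots> = distr M borel K" by (rule distr_completion[OF K])
  also have "\<dots> = distr (distr M borel V) borel (\<lambda>y. of_real y * cis r)"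
    by (subst distr_distr) (auto simp: K_def o_def)
  also have "\<dots> = density (ray_arclength r) (\<lambda>z. ennreal (f (norm z)))"
  proof (rule measure_eqI)
    fix A assume "A \<in> sets (distr (distr M borel V) borel (\<lambda>y. of_real y * cis r))"
    then have A [measurable]: "A \<in> sets borel" by simp
    have "emeasure (density (ray_arclength r) (\<lambda>z. ennreal (f (norm z)))) A =
      (\<integral>\<^sup>+z. ennreal (f (norm z)) * indicator A z \<partial>ray_arclength r)"
      by (subst emeasure_density) auto
    also have "\<dots> = (\<integral>\<^sup>+y. ennreal (f (norm (of_real y * cis r))) * indicator A (of_real y * cis r) \<partial>restrict_space lborel {0<..})"
      unfolding ray_arclength_def by (subst nn_integral_distr) auto
    also have "\<dots> = (\<integral>\<^sup>+y. ennreal (f (norm (of_real y * cis r))) * indicator A (of_real y * cis r) * indicator {0<..} y \<partial>lborel)"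
      by (subst nn_integral_restrict_space) auto
    also have "\<dots> = (\<integral>\<^sup>+y. ennreal (f y) * indicator {0<..} y * indicator ((\<lambda>y. of_real y * cis r) -` A) y \<partial>lborel)"
      by (intro nn_integral_cong) (auto simp: indicator_def norm_mult)
    also have "\<dots> = emeasure (density lborel (\<lambda>y. ennreal (f y) * indicator {0<..} y)) ((\<lambda>y. of_real y * cis r) -` A)"
      by (subst emeasure_density) (auto intro: measurable_sets_borel[OF _ A])
    also have "\<dots> = emeasure (distr (distr M borel V) borel (\<lambda>y. of_real y * cis r)) A"
      by (subst emeasure_distr) (auto simp: distr)
    finally show "emeasure (distr (distr M borel V) borel (\<lambda>y. of_real y * cis r)) A =
      emeasure (density (ray_arclength r) (\<lambda>z. ennreal (f (norm z)))) A" ..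
  qed simp
  finally show ?thesis
    using HR by (simp add: distributed_def)
qed

section \<open>The law of the hitting point\<close>

lemma arg_hitting_point_at_first_hit:
  assumes cont: "continuous_on {0..} \<gamma>" and \<gamma>0: "\<gamma> 0 = 1" and nz: "\<And>t. 0 \<le> t \<Longrightarrow> \<gamma> t \<noteq> 0"
    and r: "0 < r" and hit: "\<exists>t\<ge>0. continuous_arg \<gamma> t = r"
  obtains \<tau> where "0 \<le> \<tau>" "Im (logpath \<gamma> \<tau>) = r" "\<And>t. 0 \<le> t \<Longrightarrow> t < \<tau> \<Longrightarrow> Im (logpath \<gamma> t) < r"
    "arg_hitting_point r \<gamma> = exp (logpath \<gamma> \<tau>)"
proof -
  define \<theta> where "\<theta> = continuous_arg \<gamma>"
  have Im: "Im (logpath \<gamma> t) = \<theta> t" for t by (simp add: logpath_def \<theta>_def)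
  have W: "continuous_on {0..} (logpath \<gamma>)" "logpath \<gamma> 0 = 0" "\<And>t. 0 \<le> t \<Longrightarrow> \<gamma> t = exp (logpath \<gamma> t)"
    by (rule logpath[OF cont \<gamma>0 nz], assumption)+
  have cont\<theta>: "continuous_on {0..} \<theta>"
    using continuous_on_Im[OF W(1)] by (simp add: Im cong: continuous_on_cong)
  have \<theta>0: "\<theta> 0 = 0" using Im[of 0] W(2) by simp
  define T where "T = {t \<in> {0..}. \<theta> t = r}"
  have "closed T" unfolding T_def by (intro continuous_closed_preimage_constant cont\<theta>) auto
  moreover have ne: "T \<noteq> {}" using hit by (auto simp: T_def \<theta>_def)
  moreover have bdd: "bdd_below T" by (rule bdd_belowI[of _ 0]) (simp add: T_def)
  ultimately have in_T: "Inf T \<in> T" by (intro closed_contains_Inf)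
  define \<tau> where "\<tau> = Inf T"
  have \<tau>: "0 \<le> \<tau>" "\<theta> \<tau> = r" using in_T by (auto simp: T_def \<tau>_def)
  have least: "\<tau> \<le> t" if "0 \<le> t" "\<theta> t = r" for t
    unfolding \<tau>_def by (rule cInf_lower[OF _ bdd]) (use that in \<open>simp add: T_def\<close>)
  have below: "\<theta> t < r" if t: "0 \<le> t" "t < \<tau>" for t
  proof (rule ccontr)
    assume "\<not> \<theta> t < r"
    moreover have "continuous_on {0..t} \<theta>" by (rule continuous_on_subset[OF cont\<theta>]) auto
    ultimately obtain x where "0 \<le> x" "x \<le> t" "\<theta> x = r"
      using IVT'[of \<theta> 0 r t] \<theta>0 r t by auto
    then show False using least[of x] t by simp
  qed
  have "arg_hitting_time r \<gamma> = ereal \<tau>"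
    unfolding arg_hitting_time_def \<theta>_def[symmetric]
  proof (rule antisym)
    show "Inf {ereal t |t. 0 \<le> t \<and> \<theta> t = r} \<le> ereal \<tau>"
      by (rule Inf_lower) (use \<tau> in blast)
    show "ereal \<tau> \<le> Inf {ereal t |t. 0 \<le> t \<and> \<theta> t = r}"
      by (rule Inf_greatest) (use least in auto)
  qed
  then have "arg_hitting_point r \<gamma> = exp (logpath \<gamma> \<tau>)"
    using W(3)[OF \<tau>(1)] by (simp add: arg_hitting_point_def)
  with \<tau> below show ?thesis by (intro that[of \<tau>]) (simp_all add: Im)
qed

lemma Im_Ln_right_half_plane:
  assumes "0 < Re u" shows "Im (Ln u) = arctan (Im u / Re u)"
proof -
  define y where "y = Im (Ln u)"
  have u0: "u \<noteq> 0" using assms by auto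
  have y: "\<bar>y\<bar> < pi / 2" unfolding y_def using assms by (rule Re_Ln_pos_lt_imp)
  have "u = exp (Ln u)" using u0 by simp
  then have "Re u = exp (Re (Ln u)) * cos y" "Im u = exp (Re (Ln u)) * sin y"
    unfolding y_def by (metis Re_exp, metis Im_exp)
  then have "Im u / Re u = tan y" by (simp add: tan_def)
  then show ?thesis using arctan_unique[of y "Im u / Re u"] y by (simp add: y_def abs_less_iff)
qed

context prob_space
begin

text \<open>
  The form in which dominated convergence carries an exact identity to the limit.
\<close>

lemma expectation_limit_const:
  fixes f :: "nat \<Rightarrow> 'a \<Rightarrow> real"
  assumes "\<And>n. f n \<in> borel_measurable M" "g \<in> borel_measurable M"
    and "AE \<omega> in M. (\<lambda>n. f n \<omega>) \<longlonglongrightarrow> g \<omega>"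
    and "\<And>n \<omega>. \<bar>f n \<omega>\<bar> \<le> C" and c: "\<And>n. expectation (f n) = c"
  shows "expectation g = c"
proof -
  have "(\<lambda>n. expectation (f n)) \<longlonglongrightarrow> expectation g"
    by (rule integral_dominated_convergence[where w="\<lambda>_. C"]) (use assms in auto)
  then show ?thesis unfolding c by (simp add: LIMSEQ_const_iff)
qed

text \<open>
  The iterated limit, first in the mesh and then in the level, is taken of measurable
  functions and so provides a measurable version of \<open>W \<tau>\<close>.  The truncation \<open>\<eta>\<close> has to be
  small compared with \<open>s\<close>, but the limit is \<open>W \<tau>\<close> whatever \<open>\<eta>\<close> is.
\<close>

lemma bm_hitting_point_law:
  assumes bm: "planar_brownian_motion 1 B" and r: "0 < r"
  obtains X where "random_variable borel X"
    "AE \<omega> in M. arg_hitting_point r (\<lambda>t. B t \<omega>) = of_real (exp (X \<omega>)) * cis r"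
    "\<And>s b. 0 < s \<Longrightarrow> expectation (\<lambda>\<omega>. arctan ((X \<omega> - b) / s)) = - arctan (b / (s + r))"
proof -
  have cont: "AE \<omega> in M. continuous_on {0..} (\<lambda>t. B t \<omega>)" and start: "AE \<omega> in M. B 0 \<omega> = 1"
    using bm unfolding planar_brownian_motion_def by auto
  define \<rho> where "\<rho> m = r - r / real (m + 2)" for m :: nat
  have \<rho>0: "0 \<le> \<rho> m" "\<rho> m < r" for m
    using r by (simp_all add: \<rho>_def field_simps)
  have "(\<lambda>m. r / real (m + 2)) \<longlonglongrightarrow> 0"
    by (rule LIMSEQ_ignore_initial_segment[OF lim_const_over_n])
  then have \<rho>lim: "\<rho> \<longlonglongrightarrow> r"
    unfolding \<rho>_def[abs_def] using tendsto_diff[OF tendsto_const, of _ 0 sequentially r] by simp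
  define Y where "Y \<eta> m n \<omega> = walk \<eta> {w. \<rho> m \<le> Im w} (grid_increment (\<lambda>t. B t \<omega>) n) (m * 2 ^ n)" for \<eta> m n \<omega>
  define Z where "Z \<eta> m \<omega> = lim (\<lambda>n. Y \<eta> m n \<omega>)" for \<eta> m \<omega>
  define X where "X \<omega> = Re (lim (\<lambda>m. Z (1/8) m \<omega>))" for \<omega>
  have S: "{w. \<rho> m \<le> Im w} \<in> sets borel" for m by measurable
  have Ym: "Y \<eta> m n \<in> borel_measurable M" if "\<eta> < 1" for \<eta> m n
    unfolding Y_def[abs_def] by (rule bm_walk_rv[OF bm S that])
  have Zm: "Z \<eta> m \<in> borel_measurable M" if "\<eta> < 1" for \<eta> m
    unfolding Z_def[abs_def] by (rule borel_measurable_lim_metric[OF Ym[OF that]])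
  have Xm [measurable]: "X \<in> borel_measurable M"
  proof -
    have "(\<lambda>\<omega>. lim (\<lambda>m. Z (1/8) m \<omega>)) \<in> borel_measurable M"
      by (rule borel_measurable_lim_metric[OF Zm]) simp
    then show ?thesis unfolding X_def[abs_def] by measurable
  qed
  have key: "AE \<omega> in M. arg_hitting_point r (\<lambda>t. B t \<omega>) = exp (Complex (X \<omega>) r) \<and>
      (\<forall>\<eta>>0. (\<forall>m. (\<lambda>n. Y \<eta> m n \<omega>) \<longlonglongrightarrow> Z \<eta> m \<omega>) \<and> (\<lambda>m. Z \<eta> m \<omega>) \<longlonglongrightarrow> Complex (X \<omega>) r)"
    using cont start bm_nonzero[OF bm] bm_hits_level[OF bm r]
  proof eventually_elim
    case (elim \<omega>)
    define W where "W = logpath (\<lambda>t. B t \<omega>)"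
    have nz: "\<And>t. 0 \<le> t \<Longrightarrow> B t \<omega> \<noteq> 0" using elim(3) by simp
    have W: "continuous_on {0..} W" "W 0 = 0" "\<And>t. 0 \<le> t \<Longrightarrow> B t \<omega> = exp (W t)"
      unfolding W_def by (rule logpath[OF elim(1,2) nz], assumption)+
    obtain \<tau> where \<tau>: "0 \<le> \<tau>" "Im (W \<tau>) = r" "\<And>t. 0 \<le> t \<Longrightarrow> t < \<tau> \<Longrightarrow> Im (W t) < r"
      and pt: "arg_hitting_point r (\<lambda>t. B t \<omega>) = exp (W \<tau>)"
      by (rule arg_hitting_point_at_first_hit[OF elim(1,2) nz r elim(4), folded W_def]) (assumption, rule that)
    have lims: "(\<forall>m. (\<lambda>n. Y \<eta> m n \<omega>) \<longlonglongrightarrow> Z \<eta> m \<omega>) \<and> (\<lambda>m. Z \<eta> m \<omega>) \<longlonglongrightarrow> W \<tau>" if \<eta>: "0 < \<eta>" for \<eta>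
    proof -
      obtain y where y: "\<And>m. (\<lambda>n. Y \<eta> m n \<omega>) \<longlonglongrightarrow> y m" "y \<longlonglongrightarrow> W \<tau>"
        by (rule walk_limits_to_hitting_point[where W=W and \<gamma>="\<lambda>t. B t \<omega>" and \<eta>=\<eta> and \<tau>=\<tau> and r=r and \<rho>=\<rho>,
              OF W \<eta> \<tau> \<rho>lim \<rho>0(2), folded Y_def]) (assumption+, rule that)
      have "Z \<eta> m \<omega> = y m" for m unfolding Z_def using y(1) by (rule limI)
      with y show ?thesis by simp
    qed
    have "(\<lambda>m. Z (1/8) m \<omega>) \<longlonglongrightarrow> W \<tau>" using lims[of "1/8"] by simp
    then have "X \<omega> = Re (W \<tau>)" unfolding X_def by (simp add: limI)
    then have "W \<tau> = Complex (X \<omega>) r" using \<tau>(2) by (simp add: complex_eq_iff)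
    with pt lims show ?case by simp
  qed
  have law: "expectation (\<lambda>\<omega>. arctan ((X \<omega> - b) / s)) = - arctan (b / (s + r))" if s: "0 < s" for s b
  proof -
    define \<eta> where "\<eta> = min (1/8) (s/8)"
    define \<zeta> where "\<zeta> = Complex (s + r) (- b)"
    have \<eta>: "0 < \<eta>" "\<eta> < 1/4" "\<eta> < 1" using s by (auto simp: \<eta>_def)
    have \<rho>\<zeta>: "\<rho> m + 4 * \<eta> \<le> Re \<zeta>" for m
    proof -
      have "\<eta> \<le> s / 8" by (simp add: \<eta>_def)
      then show ?thesis using \<rho>0(2)[of m] s by (simp add: \<zeta>_def)
    qed
    note [measurable] = Ym[OF \<eta>(3)] Zm[OF \<eta>(3)]
    have EY: "expectation (\<lambda>\<omega>. Im (half_plane_Ln \<zeta> (Y \<eta> m n \<omega>))) = Im (Ln \<zeta>)" for m n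
      using bm_expectation_half_plane_Ln(3,4)[OF bm \<eta>(1,2) \<rho>0(1)[of m] \<rho>\<zeta>[of m], of n "m * 2 ^ n"]
      unfolding Y_def by simp
    have EZ: "expectation (\<lambda>\<omega>. Im (half_plane_Ln \<zeta> (Z \<eta> m \<omega>))) = Im (Ln \<zeta>)" for m
    proof (rule expectation_limit_const[where f="\<lambda>n \<omega>. Im (half_plane_Ln \<zeta> (Y \<eta> m n \<omega>))" and C=pi, OF _ _ _ abs_Im_half_plane_Ln_le EY])
      show "AE \<omega> in M. (\<lambda>n. Im (half_plane_Ln \<zeta> (Y \<eta> m n \<omega>))) \<longlonglongrightarrow> Im (half_plane_Ln \<zeta> (Z \<eta> m \<omega>))"
        using key
      proof eventually_elim
        case (elim \<omega>)
        then have lim: "(\<lambda>n. Y \<eta> m n \<omega>) \<longlonglongrightarrow> Z \<eta> m \<omega>" using \<eta>(1) by blast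
        have "(\<lambda>n. Re (\<zeta> + \<i> * Y \<eta> m n \<omega>)) \<longlonglongrightarrow> Re (\<zeta> + \<i> * Z \<eta> m \<omega>)"
          by (intro tendsto_intros lim)
        then have "2 * \<eta> \<le> Re (\<zeta> + \<i> * Z \<eta> m \<omega>)"
          using bm_expectation_half_plane_Ln(2)[OF bm \<eta>(1,2) \<rho>0(1)[of m] \<rho>\<zeta>[of m]]
          by (intro LIMSEQ_le_const) (auto simp only: Y_def)
        then have "0 < Re (\<zeta> + \<i> * Z \<eta> m \<omega>)" using \<eta>(1) by linarith
        from isCont_half_plane_Ln[OF this] show ?case by (intro tendsto_Im isCont_tendsto_compose[OF _ lim])
      qed
    qed measurable
    have "expectation (\<lambda>\<omega>. Im (half_plane_Ln \<zeta> (Complex (X \<omega>) r))) = Im (Ln \<zeta>)"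
    proof (rule expectation_limit_const[where f="\<lambda>m \<omega>. Im (half_plane_Ln \<zeta> (Z \<eta> m \<omega>))" and C=pi, OF _ _ _ abs_Im_half_plane_Ln_le EZ])
      have [measurable]: "(\<lambda>\<omega>. Complex (X \<omega>) r) \<in> borel_measurable M"
        unfolding Complex_eq by measurable
      show "(\<lambda>\<omega>. Im (half_plane_Ln \<zeta> (Complex (X \<omega>) r))) \<in> borel_measurable M" by measurable
      show "AE \<omega> in M. (\<lambda>m. Im (half_plane_Ln \<zeta> (Z \<eta> m \<omega>))) \<longlonglongrightarrow> Im (half_plane_Ln \<zeta> (Complex (X \<omega>) r))"
        using key
      proof eventually_elim
        case (elim \<omega>)
        then have lim: "(\<lambda>m. Z \<eta> m \<omega>) \<longlonglongrightarrow> Complex (X \<omega>) r" using \<eta>(1) by blast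
        have "0 < Re (\<zeta> + \<i> * Complex (X \<omega>) r)" using s by (simp add: \<zeta>_def)
        from isCont_half_plane_Ln[OF this] show ?case by (intro tendsto_Im isCont_tendsto_compose[OF _ lim])
      qed
    qed measurable
    moreover have "Im (half_plane_Ln \<zeta> (Complex (X \<omega>) r)) = arctan ((X \<omega> - b) / s)" for \<omega>
      using s Im_Ln_right_half_plane[of "\<zeta> + \<i> * Complex (X \<omega>) r"] by (simp add: half_plane_Ln_def \<zeta>_def)
    moreover have "Im (Ln \<zeta>) = - arctan (b / (s + r))"
      using s r Im_Ln_right_half_plane[of \<zeta>] by (simp add: \<zeta>_def arctan_minus)
    ultimately show ?thesis by simp
  qed
  have "AE \<omega> in M. arg_hitting_point r (\<lambda>t. B t \<omega>) = of_real (exp (X \<omega>)) * cis r"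
    using key by eventually_elim (auto simp: exp_eq_polar)
  from that[OF Xm this law] show ?thesis .
qed

end

theorem mainTheorem14:
  fixes M :: "'a measure" and B :: "real \<Rightarrow> 'a \<Rightarrow> complex" and r :: real
  assumes "r > 0"
    and "prob_space M"
    and "prob_space.planar_brownian_motion M 1 B"
  shows "\<exists>\<rho> :: complex \<Rightarrow> real.
           distributed (completion M) (ray_arclength r)
             (\<lambda>\<omega>. arg_hitting_point r (\<lambda>t. B t \<omega>)) (\<lambda>z. ennreal (\<rho> z)) \<and>
           (\<forall>y>0. \<rho> (complex_of_real y * cis r) = 1 / (pi * y) * (r / (r\<^sup>2 + (ln y)\<^sup>2)))"
proof -
  interpret prob_space M by fact
  obtain X where X [measurable]: "random_variable borel X"
    and HX: "AE \<omega> in M. arg_hitting_point r (\<lambda>t. B t \<omega>) = of_real (exp (X \<omega>)) * cis r"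
    and law: "\<And>s b. 0 < s \<Longrightarrow> expectation (\<lambda>\<omega>. arctan ((X \<omega> - b) / s)) = - arctan (b / (s + r))"
    using bm_hitting_point_law[OF assms(3,1)] by blast
  have "distr M borel (\<lambda>\<omega>. exp (X \<omega>)) = density lborel (\<lambda>y. ennreal (exp_cauchy_density r y) * indicator {0<..} y)"
    using X assms(1) cauchy_tail[OF X assms(1) law] by (rule distr_exp_cauchy)
  then have "distributed (completion M) (ray_arclength r) (\<lambda>\<omega>. arg_hitting_point r (\<lambda>t. B t \<omega>))
      (\<lambda>z. ennreal (exp_cauchy_density r (norm z)))"
    by (intro distributed_ray[OF _ HX]) auto
  moreover have "exp_cauchy_density r (norm (complex_of_real y * cis r)) = 1 / (pi * y) * (r / (r\<^sup>2 + (ln y)\<^sup>2))" if "0 < y" for y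
    using that by (simp add: exp_cauchy_density_def norm_mult)
  ultimately show ?thesis by (intro exI[of _ "\<lambda>z. exp_cauchy_density r (norm z)"]) blast
qed

end
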